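(* Let $M,N\ge0$ be integers with $M+N\ge1$. Let $X_1,\ldots,X_M,Y_1,\ldots,Y_N$ be independent random variables with $X_i\sim N(0,\sigma_{X_i}^2)$ and $Y_j\sim N(0,\sigma_{Y_j}^2)$, and let $Z=X/Y$ with $X=X_1\cdots X_M$ and $Y=Y_1\cdots Y_N$. Let $F_Z(z)=\mathbb{P}(Z\le z)$. Then, for $z\in\mathbb{R}$, \begin{align*} F_Z(z)&=\frac12+\frac{2^{(N-M-2)/2}s_N}{\pi^{(M+N)/2}\sigma_M}\,z\,G^{M,N+1}_{N+1,M+1}\bigg(\frac{2^Ns_N^2}{2^M\sigma_M^2}z^2\;\bigg|\;{\frac12,0,\ldots,0\atop 0,\ldots,0,-\frac12}\bigg)\\ &=\frac12+\frac{\mathrm{sgn}(z)}{2\pi^{(N+M)/2}}\,G^{M,N+1}_{N+1,M+1}\bigg(\frac{2^Ns_N^2}{2^M\sigma_M^2}z^2\;\bigg|\;{1,\frac12,\ldots,\frac12\atop \frac12,\ldots,\frac12,0}\bigg). \end{align*} In the first formula the upper parameters are $\frac12$ followed by $N$ zeros and the lower parameters are $M$ zeros followed by $-\frac12$; in the second formula the upper parameters are $1$ followed by $N$ copies of $\frac12$ and the lower parameters are $M$ copies of $\frac12$ followed by $0$.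
   Context: All standard deviations $\sigma_{X_i},\sigma_{Y_j}$ are positive. Notation: $\sigma_M=\sigma_{X_1}\cdots\sigma_{X_M}$ and $s_N=\sigma_{Y_1}\cdots\sigma_{Y_N}$. Empty products are $1$: thus $\sigma_0=1$, $s_0=1$, $X=1$ when $M=0$, and $Y=1$ when $N=0$. The sign function is $\mathrm{sgn}(z)=-1$ for $z<0$, $\mathrm{sgn}(0)=0$, $\mathrm{sgn}(z)=1$ for $z>0$. The Meijer $G$-function is defined by the contour integral $$G^{m,n}_{p,q}\bigg(x\;\bigg|\;{a_1,\ldots,a_p\atop b_1,\ldots,b_q}\bigg)=\frac{1}{2\pi \mathrm{i}}\int_L\frac{\prod_{j=1}^m\Gamma(b_j-s)\prod_{j=1}^n\Gamma(1-a_j+s)}{\prod_{j=n+1}^p\Gamma(a_j-s)\prod_{j=m+1}^q\Gamma(1-b_j+s)}\,x^s\,\mathrm{d}s,$$ where the path $L$ separates the poles of the factors $\Gamma(b_j-s)$ from those of the factors $\Gamma(1-a_j+s)$, and empty products are $1$. For $x>0$, $L$ may be taken to be a vertical line $\mathrm{Re}\,s=c$ traversed from $c-\mathrm{i}\infty$ to $c+\mathrm{i}\infty$, with $-\frac12<c<0$ in the first formula and $0<c<\frac12$ in the second. At $z=0$ the second terms on the right-hand sides are understood as their limits as $z\to0$, namely $0$. *)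

theory Defs
  imports "HOL-Probability.Probability"
begin

text \<open>
  The parameter lists are \<open>as = [a\<^sub>1, \<dots>, a\<^sub>p]\<close> and \<open>bs = [b\<^sub>1, \<dots>, b\<^sub>q]\<close>, so \<open>p\<close> and \<open>q\<close> are their
  lengths and the textbook index \<open>j\<close> corresponds to list position \<open>j - 1\<close>. In Isabelle/HOL
  \<open>Gamma\<close> is \<open>0\<close> at its poles and division by \<open>0\<close> gives \<open>0\<close>; hence a factor \<open>1 / Gamma w\<close> has
  the correct value \<open>0\<close> at every pole \<open>w\<close> of \<open>Gamma\<close>. The power \<open>x powr s\<close> is the principal one.
\<close>

definition meijer_integrand ::
  "nat \<Rightarrow> nat \<Rightarrow> complex list \<Rightarrow> complex list \<Rightarrow> complex \<Rightarrow> complex \<Rightarrow> complex" where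
  "meijer_integrand m n as bs x s =
     ((\<Prod>j<m. Gamma (bs ! j - s)) * (\<Prod>j<n. Gamma (1 - as ! j + s))) /
     ((\<Prod>j=n..<length as. Gamma (as ! j - s)) * (\<Prod>j=m..<length bs. Gamma (1 - bs ! j + s)))
     * x powr s"

text \<open>
  The line \<open>Re s = c\<close> has the poles \<open>b\<^sub>j + k\<close> of \<open>Gamma (b\<^sub>j - s)\<close>, \<open>j \<le> m\<close>, on its right and
  the poles \<open>a\<^sub>j - 1 - k\<close> of \<open>Gamma (1 - a\<^sub>j + s)\<close>, \<open>j \<le> n\<close>, on its left.
\<close>

definition meijer_separating ::
  "nat \<Rightarrow> nat \<Rightarrow> complex list \<Rightarrow> complex list \<Rightarrow> real \<Rightarrow> bool" where
  "meijer_separating m n as bs c \<longleftrightarrow>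
     (\<forall>j<m. \<forall>k::nat. c < Re (bs ! j + of_nat k)) \<and>
     (\<forall>j<n. \<forall>k::nat. Re (as ! j - 1 - of_nat k) < c)"

text \<open>
  The contour is \<open>s = c + \<i> t\<close> with \<open>t\<close> running from \<open>-\<infinity>\<close> to \<open>\<infinity>\<close>, so \<open>ds = \<i> dt\<close>.
\<close>

definition meijer_line_integral ::
  "real \<Rightarrow> nat \<Rightarrow> nat \<Rightarrow> complex list \<Rightarrow> complex list \<Rightarrow> complex \<Rightarrow> complex" where
  "meijer_line_integral c m n as bs x =
     1 / (2 * of_real pi * \<i>) *
     (\<integral>t. meijer_integrand m n as bs x (Complex c t) * \<i> \<partial>lborel)"

text \<open>
  Only vertical contours are considered. The value is required to exist as an absolutely convergent
  integral and to be the same for all separating lines.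
\<close>

definition has_meijer_G ::
  "nat \<Rightarrow> nat \<Rightarrow> complex list \<Rightarrow> complex list \<Rightarrow> complex \<Rightarrow> complex \<Rightarrow> bool" where
  "has_meijer_G m n as bs x g \<longleftrightarrow>
     (\<exists>c. meijer_separating m n as bs c) \<and>
     (\<forall>c. meijer_separating m n as bs c \<longrightarrow>
        integrable lborel (\<lambda>t. meijer_integrand m n as bs x (Complex c t)) \<and>
        meijer_line_integral c m n as bs x = g)"

definition meijer_G ::
  "nat \<Rightarrow> nat \<Rightarrow> complex list \<Rightarrow> complex list \<Rightarrow> complex \<Rightarrow> complex" where
  "meijer_G m n as bs x = (THE g. has_meijer_G m n as bs x g)"

end

theory Submission
  imports Defs
begin

text \<open>
  Up to null sets, \<open>ln (\<kappa> * Z\<^sup>2)\<close> with \<open>\<kappa> = 2 ^ N * s\<^sub>N\<^sup>2 / (2 ^ M * \<sigma>\<^sub>M\<^sup>2)\<close> is a sum \<open>S\<close> of independent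
  variables \<open>\<plusminus> ln (X\<^sup>2 / (2 * \<sigma>\<^sup>2))\<close>, and the Gamma integral gives
  \<open>E exp (- s * S) = Gamma (1/2 - s) ^ M * Gamma (1/2 + s) ^ N / pi powr ((M + N) / 2)\<close>.
  Levy's inversion theorem, applied to the probability density proportional to
  \<open>exp (- c * y) * P(S \<le> y)\<close>, recovers \<open>P(S \<le> y)\<close> from this transform on the line \<open>Re s = c\<close>; at
  \<open>y = ln (\<kappa> * z\<^sup>2)\<close> the inversion integral is the second Meijer function, and a shift of the line by
  \<open>1/2\<close> gives the first. Since \<open>Z\<close> is symmetric without atoms, \<open>P(Z \<le> z)\<close> is determined by
  \<open>P(\<bar>Z\<bar> \<le> \<bar>z\<bar>)\<close>.
\<close>

section \<open>Inversion of the Laplace transform of a distribution function\<close>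

text \<open>Levy's theorem expresses the mass of \<open>{y<..y + \<delta> n}\<close> by the
  characteristic function. Division by \<open>\<delta> n\<close> and passage to the limit give
  \<open>f y\<close> on one side, by continuity from the right, and the Fourier integral on the
  other, by dominated convergence. The identity thus holds at the given point \<open>y\<close> and
  not just almost everywhere.\<close>

lemma density_char_inversion:
  fixes f :: "real \<Rightarrow> real"
  assumes [measurable]: "f \<in> borel_measurable borel"
    and nonneg: "\<And>x. 0 \<le> f x"
    and int: "integrable lborel f" and one: "(\<integral>x. f x \<partial>lborel) = 1"
    and cont: "continuous (at_right y) f"
    and ch: "integrable lborel (char (density lborel f))"
  shows "complex_of_real (f y) =
    1 / (2 * pi) * (CLINT t|lborel. iexp (- (t * y)) * char (density lborel f) t)"
proof -
  define D where "D = density lborel f"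
  have sets_D [measurable_cong, simp]: "sets D = sets borel" and [simp]: "space D = UNIV"
    by (auto simp: D_def)
  have "emeasure D UNIV = 1"
    by (simp add: D_def emeasure_density nn_integral_eq_integral[OF int] nonneg one)
  then have "real_distribution D"
    unfolding real_distribution_def real_distribution_axioms_def by (auto intro!: prob_spaceI)
  then interpret D: real_distribution D .
  have no_atom: "measure D {a} = 0" for a
  proof -
    have "emeasure D {a} = 0"
      unfolding D_def by (subst emeasure_density) (auto intro!: nn_integral_zero' AE_I[of _ _ "{a}"])
    then show ?thesis by (simp add: measure_def)
  qed
  have f_int: "set_integrable lborel {a..b} f" for a b
    unfolding set_integrable_def by (rule integrable_mult_indicator[OF _ int]) simp
  have measure_D: "measure D {a<..b} = integral {a..b} f" for a b
  proof -
    have "measure D {a<..b} = (LBINT x:{a<..b}. f x)"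
      unfolding measure_def D_def set_lebesgue_integral_def
      by (subst emeasure_density)
        (auto simp: nonneg mult.commute ennreal_mult'' ennreal_indicator integral_eq_nn_integral 
           intro!: arg_cong[where f=enn2real] nn_integral_cong)
    also have "\<dots> = (LBINT x:{a..b}. f x)"
      unfolding set_lebesgue_integral_def
      by (intro integral_cong_AE) (auto intro!: AE_I[of _ _ "{a}"] simp: indicator_def)
    also have "\<dots> = integral {a..b} f"
      by (rule set_borel_integral_eq_integral(2)[OF f_int])
    finally show ?thesis .
  qed
  \<comment> \<open>The kernel of Levy's formula for the interval from \<open>a\<close> to
    \<open>b\<close>; division by zero makes it 0 at \<open>t = 0\<close>.\<close>
  define K where "K a b t = (iexp (- (t * a)) - iexp (- (t * b))) / (\<i> * t)" for a b t :: real
  have K_bound: "norm (K a b t) \<le> b - a" if "a \<le> b" for a b t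
  proof (cases "t = 0")
    case False
    have "norm (K a b t) = norm ((iexp (t * (- a)) - iexp (t * (- b))) / (\<i> * t))"
      by (simp add: K_def)
    also have "\<dots> \<le> - a - (- b)"
      by (rule Levy_Inversion_aux2) (use False that in auto)
    finally show ?thesis by simp
  qed (use that in \<open>auto simp: K_def\<close>)
  have [measurable]: "K a b \<in> borel_measurable borel" for a b
    unfolding K_def by measurable
  have [measurable]: "char D \<in> borel_measurable borel"
    using ch borel_measurable_integrable unfolding D_def by force
  have K_int: "integrable lborel (\<lambda>t. K a b t * char D t)" if "a \<le> b" for a b
  proof (rule Bochner_Integration.integrable_bound)
    show "integrable lborel (\<lambda>t. (b - a) *\<^sub>R norm (char D t))"
      using ch unfolding D_def by (intro integrable_scaleR_right integrable_norm)
    show "AE t in lborel. norm (K a b t * char D t) \<le> norm ((b - a) *\<^sub>R norm (char D t))"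
      using K_bound[OF that] that by (auto simp: norm_mult intro!: mult_right_mono)
  qed measurable
  \<comment> \<open>Levy's formula is a limit of integrals over growing symmetric intervals; by
    \<open>K_int\<close> that limit is an integral over the whole line.\<close>
  have interval: "complex_of_real (measure D {a<..b}) = 1 / (2 * pi) * (CLINT t|lborel. K a b t * char D t)"
    if "a \<le> b" for a b
  proof (rule LIMSEQ_unique)
    show "(\<lambda>T. 1 / (2 * pi) * (CLBINT t=-real T..real T. K a b t * char D t)) \<longlonglongrightarrow> measure D {a<..b}"
      using D.Levy_Inversion[OF that no_atom no_atom] by (simp add: K_def)
    have "(\<lambda>T. CLBINT t=-real T..real T. K a b t * char D t) \<longlonglongrightarrow> (CLINT t|lborel. K a b t * char D t)"
    proof -
      have "(CLBINT t=-real T..real T. K a b t * char D t) =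
          (CLINT t|lborel. indicator {- real T<..<real T} t *\<^sub>R (K a b t * char D t))" for T
        by (simp add: interval_lebesgue_integral_def set_lebesgue_integral_def)
      moreover have "(\<lambda>T. CLINT t|lborel. indicator {- real T<..<real T} t *\<^sub>R (K a b t * char D t))
        \<longlonglongrightarrow> (CLINT t|lborel. K a b t * char D t)"
      proof (rule integral_dominated_convergence)
        show "integrable lborel (\<lambda>t. norm (K a b t * char D t))"
          using K_int[OF that] by (rule integrable_norm)
        show "AE t in lborel. (\<lambda>T. indicator {- real T<..<real T} t *\<^sub>R (K a b t * char D t))
            \<longlonglongrightarrow> K a b t * char D t"
        proof (intro AE_I2 tendsto_eventually)
          fix t :: real
          show "\<forall>\<^sub>F T in sequentially. indicator {- real T<..<real T} t *\<^sub>R (K a b t * char D t)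
            = K a b t * char D t"
            using eventually_gt_at_top[of "nat \<lceil>\<bar>t\<bar>\<rceil>"]
            by eventually_elim (auto simp: indicator_def, linarith+)
        qed
      qed (auto simp: indicator_def)
      ultimately show ?thesis by simp
    qed
    then show "(\<lambda>T. 1 / (2 * pi) * (CLBINT t=-real T..real T. K a b t * char D t))
        \<longlonglongrightarrow> 1 / (2 * pi) * (CLINT t|lborel. K a b t * char D t)"
      by (intro tendsto_mult tendsto_const)
  qed
  define \<delta> where "\<delta> n = 1 / real (Suc n)" for n
  have \<delta>_pos: "\<delta> n > 0" for n by (simp add: \<delta>_def)
  then have \<delta>_nz: "\<delta> n \<noteq> 0" for n by (metis less_irrefl)
  have \<delta>_lim: "\<delta> \<longlonglongrightarrow> 0"
    unfolding \<delta>_def using LIMSEQ_inverse_real_of_nat by (simp add: inverse_eq_divide)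
  have "(\<lambda>n. complex_of_real (integral {y..y + \<delta> n} f / \<delta> n)) \<longlonglongrightarrow> complex_of_real (f y)"
  proof (rule tendsto_of_real)
    have "f integrable_on {y..y + 1}"
      by (rule set_borel_integral_eq_integral(1)[OF f_int])
    moreover have "continuous (at y within ({y..y + 1} - {})) f"
      using continuous_within_subset[of y "{y..}" f "{y..y+1}"] cont
      by (auto simp: continuous_within tendsto_at_iff_tendsto_nhds at_within_Icc_at_right)
    ultimately have "((\<lambda>u. integral {y..u} f) has_vector_derivative f y) (at y within ({y..y + 1} - {}))"
      by (intro integral_has_vector_derivative_continuous_at) auto
    then have *: "((\<lambda>u. integral {y..u} f / (u - y)) \<longlongrightarrow> f y) (at_right y)"
      by (simp add: has_real_derivative_iff_has_vector_derivative[symmetric] has_field_derivative_iff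
          at_within_Icc_at_right)
    have "filterlim (\<lambda>n. y + \<delta> n) (at_right y) sequentially"
      unfolding filterlim_at using \<delta>_pos \<delta>_nz tendsto_add[OF tendsto_const \<delta>_lim, of y] by auto
    from filterlim_compose[OF * this]
    show "(\<lambda>n. integral {y..y + \<delta> n} f / \<delta> n) \<longlonglongrightarrow> f y" by simp
  qed
  moreover have "complex_of_real (integral {y..y + \<delta> n} f / \<delta> n) =
      1 / (2 * pi) * (CLINT t|lborel. K y (y + \<delta> n) t / \<delta> n * char D t)" for n
  proof -
    have "(CLINT t|lborel. K y (y + \<delta> n) t / \<delta> n * char D t) =
       (CLINT t|lborel. (K y (y + \<delta> n) t * char D t) / \<delta> n)" by simp
    also have "\<dots> = (CLINT t|lborel. (K y (y + \<delta> n) t * char D t)) / \<delta> n"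
      by (rule integral_divide_zero)
    finally show ?thesis
      using interval[of y "y + \<delta> n"] \<delta>_pos[of n] by (simp add: measure_D less_imp_le)
  qed
  ultimately have "(\<lambda>n. 1 / (2 * pi) * (CLINT t|lborel. K y (y + \<delta> n) t / \<delta> n * char D t)) 
      \<longlonglongrightarrow> complex_of_real (f y)" by simp
  moreover have "(\<lambda>n. CLINT t|lborel. K y (y + \<delta> n) t / \<delta> n * char D t) 
      \<longlonglongrightarrow> (CLINT t|lborel. iexp (- (t * y)) * char D t)"
  proof (rule integral_dominated_convergence)
    show "integrable lborel (\<lambda>t. norm (char D t))"
      using ch unfolding D_def by (rule integrable_norm)
    show "AE t in lborel. norm (K y (y + \<delta> n) t / \<delta> n * char D t) \<le> norm (char D t)" for n
    proof (intro AE_I2)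
      fix t
      have "norm (K y (y + \<delta> n) t / \<delta> n) \<le> 1"
        using K_bound[of y "y + \<delta> n" t] \<delta>_pos[of n] by (simp add: norm_divide)
      then show "norm (K y (y + \<delta> n) t / \<delta> n * char D t) \<le> norm (char D t)"
        unfolding norm_mult by (intro mult_left_le_one_le) auto
    qed
    show "AE t in lborel. (\<lambda>n. K y (y + \<delta> n) t / \<delta> n * char D t) \<longlonglongrightarrow> iexp (- (t * y)) * char D t"
    \<comment> \<open>At \<open>t = 0\<close> the kernel is 0 by convention, whereas the claimed
      limit is \<open>char D 0 = 1\<close>, so this point is excepted.\<close>
    proof (rule AE_I[of _ _ "{0}"])
      have "(\<lambda>n. K y (y + \<delta> n) t / \<delta> n * char D t) \<longlonglongrightarrow> iexp (- (t * y)) * char D t"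
        if t: "t \<noteq> 0" for t
      proof (intro tendsto_mult tendsto_const)
        have "(\<lambda>n. t * \<delta> n) \<longlonglongrightarrow> t * 0"
          by (intro tendsto_mult tendsto_const \<delta>_lim)
        then have "filterlim (\<lambda>n. t * \<delta> n) (at 0) sequentially"
          unfolding filterlim_at using t \<delta>_nz by auto
        \<comment> \<open>With \<open>iexp (- (t * y))\<close> taken out, the kernel divided by
          \<open>\<delta> n\<close> is \<open>(1 - iexp (- u)) / (\<i> * u)\<close> at
          \<open>u = t * \<delta> n\<close>, which tends to 1 as \<open>u\<close> tends to
          0.\<close>
        from filterlim_compose[OF Levy_Inversion_aux1[of 0 1] this]
        have "(\<lambda>n. iexp (- (t * y)) * ((1 - iexp (- (t * \<delta> n))) / (\<i> * of_real (t * \<delta> n)))) 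
          \<longlonglongrightarrow> iexp (- (t * y)) * 1"
          by (intro tendsto_mult tendsto_const) simp
        also have "(\<lambda>n. iexp (- (t * y)) * ((1 - iexp (- (t * \<delta> n))) / (\<i> * of_real (t * \<delta> n)))) =
            (\<lambda>n. K y (y + \<delta> n) t / \<delta> n)"
          by (simp add: K_def fun_eq_iff right_diff_distrib mult_exp_exp algebra_simps)
        finally show "(\<lambda>n. K y (y + \<delta> n) t / \<delta> n) \<longlonglongrightarrow> iexp (- (t * y))" by simp
      qed
      then show "{t \<in> space lborel. \<not> (\<lambda>n. K y (y + \<delta> n) t / \<delta> n * char D t) \<longlonglongrightarrow> iexp (- (t * y)) * char D t} \<subseteq> {0}"
        by auto
    qed auto
  qed measurable
  then have "(\<lambda>n. 1 / (2 * pi) * (CLINT t|lborel. K y (y + \<delta> n) t / \<delta> n * char D t)) 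
      \<longlonglongrightarrow> 1 / (2 * pi) * (CLINT t|lborel. iexp (- (t * y)) * char D t)"
    by (intro tendsto_mult tendsto_const)
  ultimately show ?thesis
    unfolding D_def using LIMSEQ_unique by blast
qed

text \<open>The integrand has modulus \<open>exp (- Re s * y)\<close>, and its antiderivative
  \<open>- exp (- s * y) / s\<close> vanishes at infinity. This is the inner integral in the Fubini
  argument of \<open>cdf_laplace\<close>.\<close>

lemma exp_integral_atLeast:
  fixes s :: complex and x :: real
  assumes "Re s > 0"
  shows "set_integrable lborel {x..} (\<lambda>y. exp (- s * of_real y))"
    and "(LBINT y:{x..}. exp (- s * of_real y)) = exp (- s * of_real x) / s"
proof -
  have "(\<lambda>y. exp (- Re s * y)) absolutely_integrable_on {x..}"
    using has_integral_exp_minus_to_infinity[OF assms, of x]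
    by (intro nonnegative_absolutely_integrable_1) (auto simp: has_integral_iff)
  then have "set_integrable lborel {x..} (\<lambda>y. exp (- Re s * y))"
    by (simp add: set_integrable_def integrable_completion)
  then show int: "set_integrable lborel {x..} (\<lambda>y. exp (- s * of_real y))"
    by (rule set_integrable_bound) (auto simp: set_borel_measurable_def)
  have "(LBINT y:{x..}. exp (- s * of_real y)) = (LBINT y=x..\<infinity>. exp (- s * of_real y))"
    unfolding interval_lebesgue_integral_def set_lebesgue_integral_def
    by (auto intro!: integral_cong_AE eventually_mono[OF AE_lborel_singleton[of x]] split: split_indicator)
  also have "\<dots> = 0 - (- exp (- s * of_real x) / s)"
  proof (rule interval_integral_FTC_integrable)
    show "((\<lambda>y. - exp (- s * of_real y) / s) has_vector_derivative exp (- s * of_real y)) (at y)" for y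
      using assms by (auto intro!: derivative_eq_intros has_vector_derivative_real_field simp: field_simps)
    show "isCont (\<lambda>y. exp (- s * complex_of_real y)) y" for y
      by (intro continuous_intros)
    show "set_integrable lborel (einterval (ereal x) \<infinity>) (\<lambda>y. exp (- s * complex_of_real y))"
      by (rule set_integrable_subset[OF int]) auto
    have "((\<lambda>y. - exp (- s * of_real y) / s) \<longlongrightarrow> - exp (- s * of_real x) / s) (at_right x)"
      using assms by (intro tendsto_intros) auto
    then show "(((\<lambda>y. - exp (- s * of_real y) / s) \<circ> real_of_ereal) \<longlongrightarrow> - exp (- s * of_real x) / s) (at_right (ereal x))"
      by (simp add: ereal_tendsto_simps)
    have "filterlim (\<lambda>y. - Re s * y) at_bot at_top"
      using assms by (intro filterlim_tendsto_neg_mult_at_bot[OF tendsto_const] filterlim_ident) auto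
    then have "((\<lambda>y. exp (- Re s * y) / norm s) \<longlongrightarrow> 0 / norm s) at_top"
      using assms by (intro tendsto_divide tendsto_const filterlim_compose[OF exp_at_bot]) auto
    then have "((\<lambda>y. - exp (- s * of_real y) / s) \<longlongrightarrow> 0) at_top"
      by (intro tendsto_norm_zero_cancel[of "\<lambda>y. - exp (- s * of_real y) / s"])
         (simp add: norm_divide)
    then show "(((\<lambda>y. - exp (- s * of_real y) / s) \<circ> real_of_ereal) \<longlongrightarrow> 0) (at_left \<infinity>)"
      by (simp add: ereal_tendsto_simps)
  qed simp
  finally show "(LBINT y:{x..}. exp (- s * of_real y)) = exp (- s * of_real x) / s" by simp
qed

section \<open>Laplace transforms of distribution functions and their inversion\<close>

context real_distribution
begin

text \<open>Fubini's theorem on the region \<open>x \<le> y\<close>: integrating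
  \<open>exp (- s * y)\<close> over \<open>x\<close> first produces \<open>cdf M y\<close>, over
  \<open>y\<close> first \<open>exp (- s * x) / s\<close>. The exponential moment makes the double
  integral absolutely convergent.\<close>

lemma cdf_laplace:
  assumes s: "Re s > 0" and int: "integrable M (\<lambda>x. exp (- Re s * x))"
  shows "integrable lborel (\<lambda>y. exp (- s * of_real y) * of_real (cdf M y))"
    and "(CLINT y|lborel. exp (- s * of_real y) * of_real (cdf M y)) =
      (CLINT x|M. exp (- s * of_real x)) / s"
proof -
  interpret P: pair_sigma_finite M "lborel :: real measure" ..
  let ?f = "\<lambda>x y. indicator {x..} y *\<^sub>R exp (- s * complex_of_real y)"
  have norm_inner: "(LBINT y. norm (?f x y)) = exp (- Re s * x) / Re s" for x
  proof -
    have "complex_of_real (LBINT y. norm (?f x y)) = (LBINT y:{x..}. exp (- of_real (Re s) * of_real y))"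
      unfolding set_lebesgue_integral_def integral_complex_of_real[symmetric]
      by (auto simp flip: exp_of_real intro!: Bochner_Integration.integral_cong split: split_indicator)
    also have "\<dots> = of_real (exp (- Re s * x) / Re s)"
      using exp_integral_atLeast(2)[of "of_real (Re s)" x] s by (simp flip: exp_of_real)
    finally show ?thesis
      using of_real_eq_iff by blast
  qed
  have prod: "integrable (M \<Otimes>\<^sub>M lborel) (case_prod ?f)"
  proof (rule P.Fubini_integrable)
    have "{z \<in> space (borel \<Otimes>\<^sub>M borel). fst z \<le> (snd z :: real)} \<in> sets (borel \<Otimes>\<^sub>M borel)"
      by measurable
    then have "{z :: real \<times> real. fst z \<le> snd z} \<in> sets (borel \<Otimes>\<^sub>M borel)"
      by (simp add: space_pair_measure)
    then have "(\<lambda>z. indicator {z. fst z \<le> snd z} z *\<^sub>R exp (- s * complex_of_real (snd z)))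
        \<in> borel_measurable (M \<Otimes>\<^sub>M lborel)"
      by measurable
    also have "(\<lambda>z. indicator {z. fst z \<le> snd z} z *\<^sub>R exp (- s * complex_of_real (snd z))) = case_prod ?f"
      by (auto simp: indicator_def fun_eq_iff)
    finally show "case_prod ?f \<in> borel_measurable (M \<Otimes>\<^sub>M lborel)" .
    show "integrable M (\<lambda>x. LBINT y. norm (case (x, y) of (x, y) \<Rightarrow> ?f x y))"
      using int unfolding prod.case norm_inner by simp
    show "AE x in M. integrable lborel (\<lambda>y. case (x, y) of (x, y) \<Rightarrow> ?f x y)"
      using exp_integral_atLeast(1)[OF s] by (simp add: set_integrable_def)
  qed
  have inner: "(CLINT x|M. ?f x y) = exp (- s * of_real y) * of_real (cdf M y)" for y
  proof -
    have "(CLINT x|M. ?f x y) = (CLINT x|M. indicator {..y} x *\<^sub>R exp (- s * complex_of_real y))"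
      by (intro Bochner_Integration.integral_cong) (auto simp: indicator_def)
    then show ?thesis
      by (simp add: cdf_def scaleR_conv_of_real)
  qed
  show "integrable lborel (\<lambda>y. exp (- s * of_real y) * of_real (cdf M y))"
    using P.integrable_snd[OF prod] by (simp only: inner)
  have "(CLINT y|lborel. exp (- s * of_real y) * of_real (cdf M y)) = (CLINT y|lborel. CLINT x|M. ?f x y)"
    by (simp only: inner)
  also have "\<dots> = (CLINT x|M. CLINT y|lborel. ?f x y)"
    by (rule P.Fubini_integral[OF prod])
  also have "\<dots> = (CLINT x|M. exp (- s * of_real x) / s)"
    using exp_integral_atLeast(2)[OF s] by (simp add: set_lebesgue_integral_def)
  finally show "(CLINT y|lborel. exp (- s * of_real y) * of_real (cdf M y)) =
      (CLINT x|M. exp (- s * of_real x)) / s" by simp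
qed

text \<open>The function \<open>exp (- c * u) * cdf M u\<close> is integrable, so division by its
  integral gives a probability density, to which \<open>density_char_inversion\<close> applies.
  Right continuity of the distribution function yields the formula at every
  \<open>y\<close>.\<close>

theorem cdf_laplace_inversion:
  fixes c y :: real
  defines "\<psi> \<equiv> \<lambda>s. (CLINT x|M. exp (- s * of_real x))"
  assumes c: "c > 0" and int: "integrable M (\<lambda>x. exp (- c * x))"
    and \<psi>: "integrable lborel (\<lambda>t. \<psi> (Complex c t) / Complex c t)"
  shows "complex_of_real (cdf M y) =
    1 / (2 * pi) * (CLINT t|lborel. \<psi> (Complex c t) / Complex c t * exp (Complex c t * of_real y))"
proof -
  define h where "h u = exp (- c * u) * cdf M u" for u
  have h_nonneg: "h u \<ge> 0" for u by (simp add: h_def cdf_nonneg)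
  have cdf_meas [measurable]: "cdf M \<in> borel_measurable borel"
    by (intro borel_measurable_mono monoI cdf_nondecreasing)
  have h_meas [measurable]: "h \<in> borel_measurable borel"
    unfolding h_def by measurable
  have exp_real: "exp (- complex_of_real c * of_real u) = of_real (exp (- c * u))" for u
    by (simp flip: exp_of_real)
  have h_eq: "exp (- complex_of_real c * of_real u) * of_real (cdf M u) = of_real (h u)" for u
    by (simp only: exp_real h_def of_real_mult)
  have "integrable lborel (\<lambda>u. complex_of_real (h u))"
    using cdf_laplace(1)[of "of_real c"] c int unfolding h_eq by simp
  then have h_int: "integrable lborel h"
    by (simp add: complex_of_real_integrable_eq)
  define C where "C = (LBINT u. h u)"
  have "complex_of_real C = (CLINT y|lborel. exp (- of_real c * of_real y) * of_real (cdf M y))"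
    unfolding C_def integral_complex_of_real[symmetric] h_eq ..
  also have "\<dots> = complex_of_real ((LINT x|M. exp (- c * x)) / c)"
    using cdf_laplace(2)[of "of_real c"] c int unfolding exp_real by simp
  finally have "C = (LINT x|M. exp (- c * x)) / c"
    using of_real_eq_iff by blast
  moreover have "(LINT x|M. exp (- c * x)) > 0"
    using int by (intro expectation_greater) auto
  ultimately have C: "C > 0" using c by simp
  define f where "f u = h u / C" for u
  have f_meas [measurable]: "f \<in> borel_measurable borel"
    unfolding f_def by measurable
  \<comment> \<open>Since \<open>exp (- c * u) * iexp (t * u) = exp (- Complex c (- t) * u)\<close>,
    the characteristic function runs along the line in the opposite direction; substituting
    \<open>- t\<close> for \<open>t\<close> later restores it.\<close>
  have char_f: "char (density lborel f) t = \<psi> (Complex c (- t)) / Complex c (- t) / C" for t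
  proof -
    have "char (density lborel f) t = (CLINT u|lborel. f u *\<^sub>R iexp (t * u))"
      unfolding char_def using h_nonneg C by (subst integral_density) (auto simp: f_def)
    also have "\<dots> = (CLINT u|lborel. exp (- Complex c (- t) * of_real u) * of_real (cdf M u) / C)"
      by (intro Bochner_Integration.integral_cong)
        (auto simp: f_def h_def scaleR_conv_of_real exp_of_real[symmetric] mult_exp_exp complex_eq_iff 
           Complex_eq algebra_simps)
    also have "\<dots> = \<psi> (Complex c (- t)) / Complex c (- t) / C"
      using cdf_laplace(2)[of "Complex c (- t)"] c int by (simp add: \<psi>_def)
    finally show ?thesis .
  qed
  have "complex_of_real (f y) =
    1 / (2 * pi) * (CLINT t|lborel. iexp (- (t * y)) * char (density lborel f) t)"
  proof (rule density_char_inversion)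
    show "f \<in> borel_measurable borel" by measurable
    show "0 \<le> f x" for x using h_nonneg C by (simp add: f_def)
    show "integrable lborel f" unfolding f_def using h_int by simp
    show "(LBINT x. f x) = 1" unfolding f_def using C by (simp add: C_def)
    show "continuous (at_right y) f"
      unfolding f_def h_def using C
      by (intro continuous_intros cdf_is_right_cont) auto
    show "complex_integrable lborel (char (density lborel f))"
      unfolding char_f[abs_def] using lborel_integrable_real_affine[OF \<psi>, of "-1" 0]
      by (intro integrable_divide_zero) simp
  qed
  also have "(CLINT t|lborel. iexp (- (t * y)) * char (density lborel f) t) =
     (CLINT t|lborel. iexp (t * y) * (\<psi> (Complex c t) / Complex c t / C))"
    by (subst lborel_integral_real_affine[where c="-1" and t=0]) (simp_all add: char_f)
  \<comment> \<open>Multiplication by \<open>exp (c * y) * C\<close> undoes the damping and the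
    normalization.\<close>
  finally have "of_real (exp (c * y) * C) * complex_of_real (f y) = 
    1 / (2 * pi) * (of_real (exp (c * y) * C) * (CLINT t|lborel. iexp (t * y) * (\<psi> (Complex c t) / Complex c t / C)))"
    by simp
  also have "of_real (exp (c * y) * C) * (CLINT t|lborel. iexp (t * y) * (\<psi> (Complex c t) / Complex c t / C))
    = (CLINT t|lborel. of_real (exp (c * y) * C) * (iexp (t * y) * (\<psi> (Complex c t) / Complex c t / C)))"
    by (rule integral_mult_right_zero[symmetric])
  also have "\<dots> = (CLINT t|lborel. \<psi> (Complex c t) / Complex c t * exp (Complex c t * of_real y))"
  proof (intro Bochner_Integration.integral_cong refl)
    fix t
    have "exp (Complex c t * of_real y) = of_real (exp (c * y)) * iexp (t * y)"
      by (simp add: exp_of_real[symmetric] mult_exp_exp Complex_eq algebra_simps)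
    then show "of_real (exp (c * y) * C) * (iexp (t * y) * (\<psi> (Complex c t) / Complex c t / C)) =
        \<psi> (Complex c t) / Complex c t * exp (Complex c t * of_real y)"
      using C by simp
  qed
  also have "of_real (exp (c * y) * C) * complex_of_real (f y) = of_real (cdf M y)"
    using C by (simp add: f_def h_def exp_minus field_simps flip: of_real_mult)
  finally show ?thesis .
qed

text \<open>The inversion integral is continuous in \<open>y\<close> by dominated convergence, so
  the distribution function has no jump.\<close>

corollary cdf_laplace_no_atom:
  fixes c y :: real
  defines "\<psi> \<equiv> \<lambda>s. (CLINT x|M. exp (- s * of_real x))"
  assumes c: "c > 0" and int: "integrable M (\<lambda>x. exp (- c * x))"
    and \<psi>: "integrable lborel (\<lambda>t. \<psi> (Complex c t) / Complex c t)"
  shows "measure M {y} = 0"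
proof -
  have "isCont (cdf M) y"
    unfolding continuous_at_sequentially o_def
  proof (intro allI impI)
    fix u :: "nat \<Rightarrow> real" assume u: "u \<longlonglongrightarrow> y"
    \<comment> \<open>A bound for the convergent sequence bounds \<open>exp (c * u n)\<close> by the
      constant \<open>exp (c * B)\<close>, because \<open>c > 0\<close>.\<close>
    obtain B where B: "\<And>n. \<bar>u n\<bar> \<le> B"
      using convergent_imp_Bseq[OF convergentI[OF u]] by (auto simp: Bseq_def)
    have norm_exp: "norm (exp (Complex c t * of_real v)) = exp (c * v)" for t v
      by simp
    have [measurable]: "(\<lambda>t. \<psi> (Complex c t) / Complex c t) \<in> borel_measurable borel"
      using borel_measurable_integrable[OF \<psi>] by simp
    have [measurable]: "Complex c \<in> borel_measurable borel"
      by (intro borel_measurable_continuous_onI) (simp add: Complex_eq continuous_intros)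
    have "(\<lambda>n. CLINT t|lborel. \<psi> (Complex c t) / Complex c t * exp (Complex c t * of_real (u n)))
      \<longlonglongrightarrow> (CLINT t|lborel. \<psi> (Complex c t) / Complex c t * exp (Complex c t * of_real y))"
    proof (rule integral_dominated_convergence)
      show "integrable lborel (\<lambda>t. norm (\<psi> (Complex c t) / Complex c t) * exp (c * B))"
        using \<psi> by (intro integrable_mult_left integrable_norm)
      show "AE t in lborel. (\<lambda>n. \<psi> (Complex c t) / Complex c t * exp (Complex c t * of_real (u n)))
          \<longlonglongrightarrow> \<psi> (Complex c t) / Complex c t * exp (Complex c t * of_real y)"
        by (intro AE_I2 tendsto_intros u)
      show "AE t in lborel. norm (\<psi> (Complex c t) / Complex c t * exp (Complex c t * of_real (u n)))
          \<le> norm (\<psi> (Complex c t) / Complex c t) * exp (c * B)" for n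
      proof (intro AE_I2)
        fix t
        have "u n \<le> B" using B[of n] by simp
        then show "norm (\<psi> (Complex c t) / Complex c t * exp (Complex c t * of_real (u n)))
          \<le> norm (\<psi> (Complex c t) / Complex c t) * exp (c * B)"
          using c unfolding norm_mult norm_exp by (intro mult_left_mono) auto
      qed
    qed measurable
    then have "(\<lambda>n. complex_of_real (cdf M (u n))) \<longlonglongrightarrow> complex_of_real (cdf M y)"
      unfolding cdf_laplace_inversion[OF c int \<psi>[unfolded \<psi>_def]] \<psi>_def
      by (intro tendsto_mult tendsto_const)
    then show "(\<lambda>n. cdf M (u n)) \<longlonglongrightarrow> cdf M y"
      by (simp add: tendsto_of_real_iff)
  qed
  then show ?thesis by (simp add: isCont_cdf)
qed

end

section \<open>The Gamma function on vertical lines and logarithms of normal variables\<close>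

text \<open>For \<open>t > 0\<close> the power \<open>t powr (z - 1)\<close> has modulus
  \<open>t powr (Re z - 1)\<close>, so Euler's integral for \<open>Gamma z\<close> is dominated by
  the one for \<open>Gamma (Re z)\<close>.\<close>

lemma norm_Gamma_le:
  assumes "Re z > 0"
  shows "norm (Gamma z) \<le> Gamma (Re z)"
proof -
  have "norm (integral {0..} (\<lambda>t. of_real t powr (z - 1) / complex_of_real (exp t))) \<le>
      integral {0..} (\<lambda>t. t powr (Re z - 1) / exp t)"
    using Gamma_integral_complex[OF assms] Gamma_integral_real[OF assms]
    by (intro Henstock_Kurzweil_Integration.integral_norm_bound_integral)
      (auto simp: has_integral_iff norm_divide norm_powr_real_powr)
  then show ?thesis
    using Gamma_integral_complex[OF assms] Gamma_integral_real[OF assms]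
    by (simp add: has_integral_iff)
qed

text \<open>The functional equation \<open>Gamma (z + 1) = z * Gamma z\<close> turns the bound for
  \<open>Gamma (z + 1)\<close>, constant on vertical lines, into decay of order
  \<open>1 / norm z\<close>.\<close>

lemma norm_Gamma_le_divide:
  assumes "Re z > 0"
  shows "norm (Gamma z) \<le> Gamma (Re z + 1) / norm z"
proof -
  have "z \<noteq> 0" using assms by auto
  have "z \<notin> \<int>\<^sub>\<le>\<^sub>0" using assms by (auto elim!: nonpos_Ints_cases)
  then have "norm (Gamma z) * norm z = norm (Gamma (z + 1))"
    by (simp add: Gamma_plus1 norm_mult)
  also have "\<dots> \<le> Gamma (Re z + 1)"
    using norm_Gamma_le[of "z + 1"] assms by simp
  finally show ?thesis using \<open>z \<noteq> 0\<close> by (simp add: field_simps)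
qed

text \<open>For normal \<open>x\<close> the variable \<open>u = x^2 / (2 * \<sigma>^2)\<close> has
  density proportional to \<open>u powr (- 1 / 2) * exp (- u)\<close>, and the integral is its
  moment of order \<open>z - 1 / 2\<close>. The substitution carries Euler's integral to the
  half-line \<open>x > 0\<close>; evenness supplies the other half.\<close>

lemma normal_density_log_transform:
  fixes \<sigma> :: real and z :: complex
  assumes \<sigma>: "\<sigma> > 0" and z: "Re z > 0"
  shows "has_bochner_integral lborel
    (\<lambda>x. normal_density 0 \<sigma> x *\<^sub>R exp ((z - 1 / 2) * of_real (ln (x\<^sup>2 / (2 * \<sigma>\<^sup>2)))))
    (Gamma z / of_real (sqrt pi))"
proof -
  define f where "f x = normal_density 0 \<sigma> x *\<^sub>R exp ((z - 1 / 2) * of_real (ln (x\<^sup>2 / (2 * \<sigma>\<^sup>2))))" for x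
  define g where "g x = x\<^sup>2 / (2 * \<sigma>\<^sup>2)" for x
  define F where "F t = complex_of_real t powr (z - 1) / of_real (exp t)" for t
  have [measurable]: "f \<in> borel_measurable borel"
    unfolding f_def by measurable
  have g_image: "g ` {0<..} = {0<..}"
  proof (intro equalityI subsetI)
    fix u :: real assume "u \<in> {0<..}"
    then have "u = g (\<sigma> * sqrt (2 * u))" "\<sigma> * sqrt (2 * u) \<in> {0<..}"
      using \<sigma> by (auto simp: g_def power_mult_distrib)
    then show "u \<in> g ` {0<..}" by blast
  qed (use \<sigma> in \<open>auto simp: g_def\<close>)
  have "F absolutely_integrable_on g ` {0<..} \<and> integral (g ` {0<..}) F = Gamma z"
    unfolding g_image F_def
    using Gamma_integral_complex'[OF z] absolutely_integrable_Gamma_integral'[OF z]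
    by (simp add: has_integral_iff)
  then have cv: "(\<lambda>x. \<bar>x / \<sigma>\<^sup>2\<bar> *\<^sub>R F (g x)) absolutely_integrable_on {0<..} \<and>
      integral {0<..} (\<lambda>x. \<bar>x / \<sigma>\<^sup>2\<bar> *\<^sub>R F (g x)) = Gamma z"
  proof (subst has_absolute_integral_change_of_variables_real)
    show "(g has_real_derivative x / \<sigma>\<^sup>2) (at x within {0<..})" for x
      unfolding g_def using \<sigma> by (auto intro!: derivative_eq_intros simp: field_simps power2_eq_square)
  qed (use \<sigma> in \<open>auto simp: g_def inj_on_def power2_eq_iff\<close>)
  have "(\<lambda>x. \<bar>x / \<sigma>\<^sup>2\<bar> *\<^sub>R F (g x)) absolutely_integrable_on {0<..} \<longleftrightarrow> 
      (\<lambda>x. (2 * sqrt pi) *\<^sub>R f x) absolutely_integrable_on {0<..}"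
    and "integral {0<..} (\<lambda>x. \<bar>x / \<sigma>\<^sup>2\<bar> *\<^sub>R F (g x)) = integral {0<..} (\<lambda>x. (2 * sqrt pi) *\<^sub>R f x)"
  proof -
    have eq: "\<bar>x / \<sigma>\<^sup>2\<bar> *\<^sub>R F (g x) = (2 * sqrt pi) *\<^sub>R f x" if "x \<in> {0<..}" for x
    proof -
      have x: "x > 0" and gx: "g x > 0" using that \<sigma> by (auto simp: g_def)
      \<comment> \<open>The Jacobian \<open>x / \<sigma>^2\<close> is a constant times the square
        root of \<open>g x\<close>; this raises the exponent from \<open>z - 1\<close> to
        \<open>z - 1 / 2\<close>.\<close>
      have "exp (ln (g x) / 2) = sqrt (g x)"
        using gx by (simp add: ln_sqrt[symmetric])
      also have "sqrt (g x) = x / (sqrt 2 * \<sigma>)"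
        using \<sigma> x by (simp add: g_def real_sqrt_divide real_sqrt_mult)
      finally have 1: "\<bar>x / \<sigma>\<^sup>2\<bar> = sqrt 2 / \<sigma> * exp (ln (g x) / 2)"
        using \<sigma> x by (simp add: power2_eq_square field_simps)
      have 2: "2 * sqrt pi * normal_density 0 \<sigma> x = sqrt 2 / \<sigma> * exp (- g x)"
        using \<sigma> by (simp add: normal_density_def g_def real_sqrt_mult field_simps)
      have "\<bar>x / \<sigma>\<^sup>2\<bar> *\<^sub>R F (g x) = 
          of_real (sqrt 2 / \<sigma>) * of_real (exp (ln (g x) / 2)) * (exp ((z - 1) * of_real (ln (g x))) * exp (- of_real (g x)))"
        unfolding 1 F_def scaleR_conv_of_real using gx 
        by (simp add: powr_def Ln_of_real exp_minus field_simps exp_of_real)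
      also have "\<dots> = of_real (sqrt 2 / \<sigma>) * (exp (- of_real (g x)) * exp ((z - 1 / 2) * of_real (ln (g x))))"
        by (simp add: exp_of_real[symmetric] mult_exp_exp algebra_simps)
      also have "\<dots> = of_real (sqrt 2 / \<sigma> * exp (- g x)) * exp ((z - 1 / 2) * of_real (ln (g x)))"
        by (simp flip: exp_of_real)
      also have "\<dots> = (2 * sqrt pi) *\<^sub>R f x"
        unfolding 2[symmetric] f_def scaleR_conv_of_real by (simp add: g_def)
      finally show ?thesis .
    qed
    show "(\<lambda>x. \<bar>x / \<sigma>\<^sup>2\<bar> *\<^sub>R F (g x)) absolutely_integrable_on {0<..} \<longleftrightarrow> 
      (\<lambda>x. (2 * sqrt pi) *\<^sub>R f x) absolutely_integrable_on {0<..}"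
      by (intro set_integrable_cong refl eq) auto
    show "integral {0<..} (\<lambda>x. \<bar>x / \<sigma>\<^sup>2\<bar> *\<^sub>R F (g x)) = integral {0<..} (\<lambda>x. (2 * sqrt pi) *\<^sub>R f x)"
      by (intro integral_cong eq)
  qed
  with cv have *: "(\<lambda>x. (2 * sqrt pi) *\<^sub>R f x) absolutely_integrable_on {0<..}"
    "integral {0<..} (\<lambda>x. (2 * sqrt pi) *\<^sub>R f x) = Gamma z" by auto
  from *(1) have int: "set_integrable lborel {0<..} (\<lambda>x. (2 * sqrt pi) *\<^sub>R f x)"
    unfolding set_integrable_def by (subst (asm) integrable_completion) auto
  have "(LBINT x:{0<..}. (2 * sqrt pi) *\<^sub>R f x) = Gamma z"
    using set_borel_integral_eq_integral(2)[OF int] *(2) by simp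
  with int have "has_bochner_integral lborel (\<lambda>x. indicator {0<..} x *\<^sub>R ((2 * sqrt pi) *\<^sub>R f x)) (Gamma z)"
    unfolding has_bochner_integral_iff set_integrable_def set_lebesgue_integral_def by blast
  from has_bochner_integral_scaleR_right[OF this, of "1 / (2 * sqrt pi)"]
  have "has_bochner_integral lborel (\<lambda>x. indicator {0<..} x *\<^sub>R f x) ((1 / (2 * sqrt pi)) *\<^sub>R Gamma z)"
    by (simp add: scaleR_left_commute)
  \<comment> \<open>The rule for even functions integrates over the closed half-line; the added
    endpoint is a null set.\<close>
  then have "has_bochner_integral lborel (\<lambda>x. indicator {0..} x *\<^sub>R f x) ((1 / (2 * sqrt pi)) *\<^sub>R Gamma z)"
    by (subst has_bochner_integral_cong_AE)
      (auto intro!: eventually_mono[OF AE_lborel_singleton[of 0]] split: split_indicator)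
  then have "has_bochner_integral lborel f (2 *\<^sub>R ((1 / (2 * sqrt pi)) *\<^sub>R Gamma z))"
    by (rule has_bochner_integral_even_function) (simp add: f_def normal_density_def)
  then show ?thesis
    by (simp add: f_def[abs_def] scaleR_conv_of_real field_simps)
qed

section \<open>The two Meijer functions\<close>

text \<open>Each modulus is at least a constant multiple of \<open>sqrt (1 + t^2)\<close>. Two lines
  appear because the factor \<open>1 / s\<close> and the Gamma bound decay along different
  ones.\<close>

lemma integrable_inverse_norm_lines:
  fixes c d :: real
  assumes "c \<noteq> 0" "d \<noteq> 0"
  shows "integrable lborel (\<lambda>t. 1 / (norm (Complex c t) * norm (Complex d t)))"
proof -
  \<comment> \<open>The cap at 1 gives \<open>k^2 * t^2 \<le> t^2\<close>; the other two entries
    bound \<open>k\<close> by the distances of the lines from the imaginary axis.\<close>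
  define k where "k = min (min \<bar>c\<bar> \<bar>d\<bar>) 1"
  have k: "k > 0" "k \<le> 1" "k \<le> \<bar>c\<bar>" "k \<le> \<bar>d\<bar>" using assms by (auto simp: k_def)
  have lower: "k * sqrt (1 + t\<^sup>2) \<le> norm (Complex e t)" if "k \<le> \<bar>e\<bar>" for e t
  proof -
    have "k\<^sup>2 \<le> e\<^sup>2" using that k by (metis abs_le_square_iff abs_of_pos)
    moreover have "k\<^sup>2 * t\<^sup>2 \<le> t\<^sup>2"
      using k by (intro mult_left_le_one_le) (auto simp: power_le_one)
    ultimately have "k\<^sup>2 * (1 + t\<^sup>2) \<le> e\<^sup>2 + t\<^sup>2" by (simp add: algebra_simps)
    then have "sqrt (k\<^sup>2 * (1 + t\<^sup>2)) \<le> sqrt (e\<^sup>2 + t\<^sup>2)" by (rule real_sqrt_le_mono)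
    then show ?thesis using k by (simp add: real_sqrt_mult cmod_def)
  qed
  have bound: "1 / (norm (Complex c t) * norm (Complex d t)) \<le> inverse (1 + t\<^sup>2) / k\<^sup>2" for t
  proof -
    have "(k * sqrt (1 + t\<^sup>2)) * (k * sqrt (1 + t\<^sup>2)) \<le> norm (Complex c t) * norm (Complex d t)"
      using k by (intro mult_mono lower) auto
    then have "k\<^sup>2 * (1 + t\<^sup>2) \<le> norm (Complex c t) * norm (Complex d t)"
      by (simp add: power2_eq_square algebra_simps)
    moreover have "k\<^sup>2 * (1 + t\<^sup>2) > 0"
      using k zero_le_power2[of t] by (intro mult_pos_pos zero_less_power) linarith+
    ultimately have "1 / (norm (Complex c t) * norm (Complex d t)) \<le> 1 / (k\<^sup>2 * (1 + t\<^sup>2))"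
      by (intro frac_le) auto
    then show ?thesis by (simp add: field_simps)
  qed
  have "integrable lborel (\<lambda>t::real. inverse (1 + t\<^sup>2) / k\<^sup>2)"
    using integrable_inverse_1_plus_square by (simp add: set_integrable_def)
  then show ?thesis
  proof (rule Bochner_Integration.integrable_bound)
    show "AE t in lborel. norm (1 / (norm (Complex c t) * norm (Complex d t))) \<le> norm (inverse (1 + t\<^sup>2) / k\<^sup>2)"
      using bound by (intro AE_I2) (simp add: order_trans[OF bound])
  qed (simp add: cmod_def)
qed

text \<open>Up to a power of \<open>sqrt pi\<close> this is the expectation of
  \<open>exp (- s * S)\<close>. It is also what both Meijer integrands contain, the first after a
  shift, once the two remaining Gamma factors have cancelled to \<open>1 / s\<close>.\<close>

definition gamma_factor :: "nat \<Rightarrow> nat \<Rightarrow> complex \<Rightarrow> complex" where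
  "gamma_factor M N s = Gamma (1 / 2 - s) ^ M * Gamma (1 / 2 + s) ^ N"

text \<open>
  One Gamma factor is bounded by \<open>\<bar>Gamma (w + 1)\<bar> / \<bar>w\<bar>\<close> and the others by their values on the real axis;
  together with the factor \<open>1 / s\<close> this decay suffices, so Stirling's formula is not needed.
\<close>

lemma gamma_factor_bound:
  assumes MN: "M + N \<ge> 1" and c: "- 1 / 2 < c" and cM: "M > 0 \<longrightarrow> c < 1 / 2"
  shows "\<exists>K d. d \<noteq> 0 \<and> (\<forall>t. norm (gamma_factor M N (Complex c t)) \<le> K / norm (Complex d t))"
proof -
  have N1: "norm (Gamma (1 / 2 + Complex c t)) \<le> Gamma (1 / 2 + c)" for t
    using norm_Gamma_le[of "1 / 2 + Complex c t"] c by simp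
  have M1: "norm (Gamma (1 / 2 - Complex c t)) \<le> Gamma (1 / 2 - c)" if "M > 0" for t
    using norm_Gamma_le[of "1 / 2 - Complex c t"] mp[OF cM that] by simp
  have pos: "Gamma (1 / 2 + c) \<ge> 0" using c by (intro less_imp_le Gamma_real_pos) simp
  have posM: "Gamma (1 / 2 - c) \<ge> 0" if "M > 0" using mp[OF cM that] by (intro less_imp_le Gamma_real_pos) simp
  show ?thesis
  \<comment> \<open>If \<open>M = 0\<close>, then \<open>N \<ge> 1\<close> and the decay comes from
    \<open>Gamma (1 / 2 + s)\<close>, so \<open>d = 1 / 2 + c\<close>; otherwise it comes from
    \<open>Gamma (1 / 2 - s)\<close>, so \<open>d = 1 / 2 - c\<close>.\<close>
  proof (cases "M = 0")
    case True
    then obtain n where n: "N = Suc n" using MN by (cases N) auto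
    have "norm (gamma_factor M N (Complex c t)) \<le> 
      Gamma (1 / 2 + c + 1) * Gamma (1 / 2 + c) ^ n / norm (Complex (1 / 2 + c) t)" for t
    proof -
      have eq: "1 / 2 + Complex c t = Complex (1 / 2 + c) t" by (simp add: complex_eq_iff)
      have "norm (gamma_factor M N (Complex c t)) =
          norm (Gamma (1 / 2 + Complex c t)) * norm (Gamma (1 / 2 + Complex c t)) ^ n"
        using True n by (simp add: gamma_factor_def norm_mult norm_power)
      also have "\<dots> \<le> Gamma (1 / 2 + c + 1) / norm (Complex (1 / 2 + c) t) * Gamma (1 / 2 + c) ^ n"
        using norm_Gamma_le_divide[of "1 / 2 + Complex c t"] c
        by (intro mult_mono power_mono N1 divide_nonneg_nonneg less_imp_le[OF Gamma_real_pos])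
          (auto simp: eq)
      finally show ?thesis by simp
    qed
    then show ?thesis using c by (intro exI[of _ "1 / 2 + c"] exI) auto
  next
    case False
    then obtain m where m: "M = Suc m" by (cases M) auto
    have "norm (gamma_factor M N (Complex c t)) \<le> 
      Gamma (1 / 2 - c + 1) * Gamma (1 / 2 - c) ^ m * Gamma (1 / 2 + c) ^ N / norm (Complex (1 / 2 - c) t)" for t
    proof -
      have eq: "norm (1 / 2 - Complex c t) = norm (Complex (1 / 2 - c) t)" by (simp add: cmod_def)
      have "norm (gamma_factor M N (Complex c t)) =
          norm (Gamma (1 / 2 - Complex c t)) * norm (Gamma (1 / 2 - Complex c t)) ^ m * norm (Gamma (1 / 2 + Complex c t)) ^ N"
        using m by (simp add: gamma_factor_def norm_mult norm_power)
      also have "\<dots> \<le> Gamma (1 / 2 - c + 1) / norm (Complex (1 / 2 - c) t) * Gamma (1 / 2 - c) ^ m * Gamma (1 / 2 + c) ^ N"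
        using norm_Gamma_le_divide[of "1 / 2 - Complex c t"] cM m posM pos
        by (intro mult_mono power_mono M1 N1 mult_nonneg_nonneg divide_nonneg_nonneg less_imp_le[OF Gamma_real_pos])
          (auto simp: eq)
      finally show ?thesis by simp
    qed
    then show ?thesis using cM m by (intro exI[of _ "1 / 2 - c"] exI) auto
  qed
qed

text \<open>The decay from \<open>gamma_factor_bound\<close> and the factor \<open>1 / s\<close>
  together are of order \<open>1 / t^2\<close>; measurability follows from continuity away from the
  poles.\<close>

lemma gamma_factor_integrable:
  assumes MN: "M + N \<ge> 1" and c: "0 < c" and cM: "M > 0 \<longrightarrow> c < 1 / 2"
  shows "integrable lborel (\<lambda>t. gamma_factor M N (Complex c t) / Complex c t)"
proof -
  obtain K d where d: "d \<noteq> 0" and K: "\<And>t. norm (gamma_factor M N (Complex c t)) \<le> K / norm (Complex d t)"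
    using gamma_factor_bound[of M N c] assms by auto
  have int: "integrable lborel (\<lambda>t. K * (1 / (norm (Complex d t) * norm (Complex c t))))"
    using integrable_inverse_norm_lines[of d c] c d by (intro integrable_mult_right) auto
  have pole: "z \<notin> \<int>\<^sub>\<le>\<^sub>0" if "Re z > 0" for z :: complex
    using that by (auto elim!: nonpos_Ints_cases)
  have line: "isCont (\<lambda>t. Complex c t) t" for t
    using continuous_on_Complex[OF continuous_on_const continuous_on_id, of UNIV c]
    by (simp add: continuous_on_eq_continuous_at)
  \<comment> \<open>For \<open>M = 0\<close> the line may pass through a pole of the base, but the
    power is then constantly 1.\<close>
  have "isCont (\<lambda>t. Gamma (1 / 2 - Complex c t) ^ M) t" for t
    by (cases "M = 0")
      (use cM in \<open>auto intro!: continuous_intros line isCont_Gamma pole\<close>)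
  moreover have "isCont (\<lambda>t. Gamma (1 / 2 + Complex c t) ^ N) t" for t
    using c by (auto intro!: continuous_intros line isCont_Gamma pole)
  ultimately have "isCont (\<lambda>t. gamma_factor M N (Complex c t) / Complex c t) t" for t
    unfolding gamma_factor_def using c
    by (intro isCont_divide isCont_mult line) (auto simp: complex_eq_iff)
  then have "continuous_on UNIV (\<lambda>t. gamma_factor M N (Complex c t) / Complex c t)"
    by (simp add: continuous_on_eq_continuous_at)
  then have [measurable]: "(\<lambda>t. gamma_factor M N (Complex c t) / Complex c t) \<in> borel_measurable borel"
    by (rule borel_measurable_continuous_onI)
  show ?thesis
  proof (rule Bochner_Integration.integrable_bound[OF int])
    show "AE t in lborel. norm (gamma_factor M N (Complex c t) / Complex c t)
        \<le> norm (K * (1 / (norm (Complex d t) * norm (Complex c t))))"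
    proof (intro AE_I2)
      fix t
      have "norm (gamma_factor M N (Complex c t) / Complex c t) \<le> K / norm (Complex d t) / norm (Complex c t)"
        unfolding norm_divide by (intro divide_right_mono K) auto
      also have "\<dots> \<le> norm (K * (1 / (norm (Complex d t) * norm (Complex c t))))"
        by (simp add: abs_mult divide_right_mono)
      finally show "norm (gamma_factor M N (Complex c t) / Complex c t)
        \<le> norm (K * (1 / (norm (Complex d t) * norm (Complex c t))))" .
    qed
  qed measurable
qed

text \<open>The upper parameter 1 contributes \<open>Gamma s\<close> and the lower parameter 0
  contributes \<open>1 / Gamma (1 + s)\<close>, whose product is \<open>1 / s\<close>.\<close>

lemma meijer_integrand_second:
  assumes "Re s > 0" "x > 0"
  shows "meijer_integrand M (N + 1) (1 # replicate N (1 / 2)) (replicate M (1 / 2) @ [0]) (complex_of_real x) s =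
    gamma_factor M N s / s * exp (s * of_real (ln x))"
proof -
  have "s \<notin> \<int>\<^sub>\<le>\<^sub>0" using assms by (auto elim!: nonpos_Ints_cases)
  then have G: "Gamma s \<noteq> 0" "Gamma (1 + s) = s * Gamma s" "s \<noteq> 0"
    using assms Gamma_plus1[of s] by (auto simp: Gamma_eq_zero_iff add.commute)
  have "(\<Prod>j<M. Gamma ((replicate M (1 / 2) @ [0]) ! j - s)) = Gamma (1 / 2 - s) ^ M"
    by (simp add: nth_append)
  moreover have "(\<Prod>j<N + 1. Gamma (1 - (1 # replicate N (1 / 2)) ! j + s)) = Gamma s * Gamma (1 / 2 + s) ^ N"
    unfolding Suc_eq_plus1[symmetric] prod.lessThan_Suc_shift by simp
  ultimately show ?thesis
    using assms G
    by (simp add: meijer_integrand_def gamma_factor_def powr_def Ln_of_real nth_append)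
qed

text \<open>Writing \<open>u = s + 1 / 2\<close> turns every Gamma factor into the corresponding one
  of the second function at \<open>u\<close>; the power of \<open>x\<close> leaves the factor
  \<open>1 / sqrt x\<close>.\<close>

lemma meijer_integrand_first:
  assumes "Re s > - 1 / 2" "x > 0"
  shows "meijer_integrand M (N + 1) (1 / 2 # replicate N 0) (replicate M 0 @ [- 1 / 2]) (complex_of_real x) s =
    gamma_factor M N (s + 1 / 2) / (s + 1 / 2) * exp ((s + 1 / 2) * of_real (ln x)) / of_real (sqrt x)"
proof -
  define u where "u = s + 1 / 2"
  have "Re u > 0" using assms by (simp add: u_def)
  then have "u \<notin> \<int>\<^sub>\<le>\<^sub>0" by (auto elim!: nonpos_Ints_cases)
  then have G: "Gamma u \<noteq> 0" "Gamma (u + 1) = u * Gamma u" "u \<noteq> 0"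
    using \<open>Re u > 0\<close> by (auto simp: Gamma_eq_zero_iff Gamma_plus1)
  have s: "s = u - 1 / 2" by (simp add: u_def)
  have "(\<Prod>j<M. Gamma ((replicate M 0 @ [- 1 / 2]) ! j - s)) = Gamma (1 / 2 - u) ^ M"
    by (simp add: nth_append s)
  moreover have "(\<Prod>j<N + 1. Gamma (1 - (1 / 2 # replicate N 0) ! j + s)) = Gamma u * Gamma (1 / 2 + u) ^ N"
    unfolding Suc_eq_plus1[symmetric] prod.lessThan_Suc_shift by (simp add: s add.commute)
  moreover have "complex_of_real x powr s = exp (u * of_real (ln x)) / of_real (sqrt x)"
  proof -
    have "complex_of_real x powr s = exp (u * of_real (ln x)) / exp (of_real (ln x / 2))"
      using assms by (simp add: powr_def Ln_of_real s exp_diff[symmetric] algebra_simps)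
    also have "exp (of_real (ln x / 2)) = complex_of_real (sqrt x)"
      using assms by (simp only: exp_of_real ln_sqrt[symmetric] exp_ln real_sqrt_gt_zero)
    finally show ?thesis .
  qed
  moreover have "1 - (- 1 / 2) + s = u + 1" by (simp add: s)
  ultimately show ?thesis
    using assms G unfolding u_def[symmetric]
    by (simp add: meijer_integrand_def gamma_factor_def nth_append)
qed

text \<open>Only the poles with \<open>k = 0\<close> restrict \<open>c\<close>: those of
  \<open>Gamma s\<close> from the left, and those of \<open>Gamma (1 / 2 - s)\<close> from the
  right. The latter exist only for \<open>M > 0\<close>.\<close>

lemma meijer_separating_second:
  "meijer_separating M (N + 1) (1 # replicate N (1 / 2)) (replicate M (1 / 2) @ [0]) c \<longleftrightarrow>
    0 < c \<and> (M > 0 \<longrightarrow> c < 1 / 2)"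
proof -
  have "(\<forall>j<M. \<forall>k::nat. c < Re ((replicate M (1 / 2) @ [0]) ! j + of_nat k)) \<longleftrightarrow> (M > 0 \<longrightarrow> c < 1 / 2)"
  proof -
    have "(\<forall>k::nat. c < 1 / 2 + real k) \<longleftrightarrow> c < 1 / 2"
      by (auto dest: spec[of _ 0])
    then show ?thesis by (auto simp: nth_append)
  qed
  moreover have "(\<forall>j<N + 1. \<forall>k::nat. Re ((1 # replicate N (1 / 2)) ! j - 1 - of_nat k) < c) \<longleftrightarrow> 0 < c"
    (is "?L \<longleftrightarrow> _")
  proof
    assume ?L
    from this[rule_format, of 0 0] show "0 < c" by simp
  qed (auto simp: nth_Cons less_Suc_eq_le split: nat.splits)
  ultimately show ?thesis unfolding meijer_separating_def by blast
qed

text \<open>The same strip as for the second function, moved to the left by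
  \<open>1 / 2\<close>.\<close>

lemma meijer_separating_first:
  "meijer_separating M (N + 1) (1 / 2 # replicate N 0) (replicate M 0 @ [- 1 / 2]) c \<longleftrightarrow>
    - 1 / 2 < c \<and> (M > 0 \<longrightarrow> c < 0)"
proof -
  have "(\<forall>j<M. \<forall>k::nat. c < Re ((replicate M 0 @ [- 1 / 2]) ! j + of_nat k)) \<longleftrightarrow> (M > 0 \<longrightarrow> c < 0)"
  proof -
    have "(\<forall>k::nat. c < real k) \<longleftrightarrow> c < 0"
      by (auto dest: spec[of _ 0])
    then show ?thesis by (auto simp: nth_append)
  qed
  moreover have "(\<forall>j<N + 1. \<forall>k::nat. Re ((1 / 2 # replicate N 0) ! j - 1 - of_nat k) < c) \<longleftrightarrow> - 1 / 2 < c"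
    (is "?L \<longleftrightarrow> _")
  proof
    assume ?L
    from this[rule_format, of 0 0] show "- 1 / 2 < c" by simp
  qed (auto simp: nth_Cons less_Suc_eq_le split: nat.splits)
  ultimately show ?thesis unfolding meijer_separating_def by blast
qed

text \<open>Uniqueness holds because \<open>has_meijer_G\<close> includes the existence of a
  separating line, and the integral along it determines the value.\<close>

lemma meijer_G_eqI:
  assumes "has_meijer_G m n as bs x g"
  shows "meijer_G m n as bs x = g"
  unfolding meijer_G_def using assms by (intro the_equality) (auto simp: has_meijer_G_def)

lemma meijer_line_integral_eq:
  "meijer_line_integral c m n as bs x =
    1 / (2 * pi) * (CLINT t|lborel. meijer_integrand m n as bs x (Complex c t))"
  unfolding meijer_line_integral_def by simp

text \<open>On the line \<open>Re s = c\<close> the factor \<open>exp (s * y)\<close> has the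
  constant modulus \<open>exp (c * y)\<close>.\<close>

lemma gamma_factor_integrand_integrable:
  assumes "M + N \<ge> 1" "0 < c" "M > 0 \<longrightarrow> c < 1 / 2"
  shows "integrable lborel (\<lambda>t. gamma_factor M N (Complex c t) / Complex c t * exp (Complex c t * of_real y))"
proof (rule Bochner_Integration.integrable_bound)
  note int = gamma_factor_integrable[OF assms]
  show "integrable lborel (\<lambda>t. norm (gamma_factor M N (Complex c t) / Complex c t) * exp (c * y))"
    using int by (intro integrable_mult_left integrable_norm)
  have [measurable]: "Complex c \<in> borel_measurable borel"
    by (intro borel_measurable_continuous_onI) (simp add: Complex_eq continuous_intros)
  have [measurable]: "(\<lambda>t. gamma_factor M N (Complex c t) / Complex c t) \<in> borel_measurable borel"
    using borel_measurable_integrable[OF int] by simp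
  show "(\<lambda>t. gamma_factor M N (Complex c t) / Complex c t * exp (Complex c t * of_real y)) \<in> borel_measurable lborel"
    by measurable
qed (simp add: norm_mult norm_divide)

text \<open>The hypothesis on \<open>g\<close> ranges over all admissible \<open>c\<close> because
  \<open>has_meijer_G\<close> demands the same value on every separating line. In the application
  \<open>g\<close> is a multiple of a probability free of \<open>c\<close>, which replaces an appeal
  to Cauchy's theorem.\<close>

lemma meijer_G_second:
  assumes MN: "M + N \<ge> 1" and x: "x > 0"
    and g: "\<And>c. 0 < c \<Longrightarrow> (M > 0 \<longrightarrow> c < 1 / 2) \<Longrightarrow> g =
      1 / (2 * pi) * (CLINT t|lborel. gamma_factor M N (Complex c t) / Complex c t * exp (Complex c t * of_real (ln x)))"
  shows "meijer_G M (N + 1) (1 # replicate N (1 / 2)) (replicate M (1 / 2) @ [0]) (complex_of_real x) = g"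
proof (rule meijer_G_eqI)
  \<comment> \<open>The value \<open>1 / 4\<close> lies in the strip whether or not \<open>M\<close>
    is 0.\<close>
  have "meijer_separating M (N + 1) (1 # replicate N (1 / 2)) (replicate M (1 / 2) @ [0]) (1 / 4)"
    unfolding meijer_separating_second by simp
  moreover have "integrable lborel (\<lambda>t. meijer_integrand M (N + 1) (1 # replicate N (1 / 2)) (replicate M (1 / 2) @ [0]) (of_real x) (Complex c t))
     \<and> meijer_line_integral c M (N + 1) (1 # replicate N (1 / 2)) (replicate M (1 / 2) @ [0]) (of_real x) = g"
    if "0 < c \<and> (M > 0 \<longrightarrow> c < 1 / 2)" for c
  proof -
    have c: "0 < c" "M > 0 \<longrightarrow> c < 1 / 2" using that by auto
    have eq: "meijer_integrand M (N + 1) (1 # replicate N (1 / 2)) (replicate M (1 / 2) @ [0]) (of_real x) (Complex c t) =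
        gamma_factor M N (Complex c t) / Complex c t * exp (Complex c t * of_real (ln x))" for t
      using c x by (intro meijer_integrand_second) auto
    show ?thesis
      unfolding meijer_line_integral_eq eq
      using gamma_factor_integrand_integrable[OF MN c] g[OF c] by blast
  qed
  ultimately show "has_meijer_G M (N + 1) (1 # replicate N (1 / 2)) (replicate M (1 / 2) @ [0]) (complex_of_real x) g"
    unfolding has_meijer_G_def meijer_separating_second by blast
qed

text \<open>The line at \<open>c\<close> corresponds to the line at \<open>c + 1 / 2\<close> of the
  second function, so the same hypothesis on \<open>g\<close> serves both.\<close>

lemma meijer_G_first:
  assumes MN: "M + N \<ge> 1" and x: "x > 0"
    and g: "\<And>c. 0 < c \<Longrightarrow> (M > 0 \<longrightarrow> c < 1 / 2) \<Longrightarrow> g =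
      1 / (2 * pi) * (CLINT t|lborel. gamma_factor M N (Complex c t) / Complex c t * exp (Complex c t * of_real (ln x)))"
  shows "meijer_G M (N + 1) (1 / 2 # replicate N 0) (replicate M 0 @ [- 1 / 2]) (complex_of_real x) = 
    g / of_real (sqrt x)"
proof (rule meijer_G_eqI)
  have "meijer_separating M (N + 1) (1 / 2 # replicate N 0) (replicate M 0 @ [- 1 / 2]) (- 1 / 4)"
    unfolding meijer_separating_first by simp
  moreover have "integrable lborel (\<lambda>t. meijer_integrand M (N + 1) (1 / 2 # replicate N 0) (replicate M 0 @ [- 1 / 2]) (of_real x) (Complex c t))
     \<and> meijer_line_integral c M (N + 1) (1 / 2 # replicate N 0) (replicate M 0 @ [- 1 / 2]) (of_real x) = g / of_real (sqrt x)"
    if "- 1 / 2 < c \<and> (M > 0 \<longrightarrow> c < 0)" for c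
  proof -
    have c: "0 < c + 1 / 2" "M > 0 \<longrightarrow> c + 1 / 2 < 1 / 2" using that by auto
    have "Complex c t + 1 / 2 = Complex (c + 1 / 2) t" for t
      by (simp add: complex_eq_iff)
    then have eq: "meijer_integrand M (N + 1) (1 / 2 # replicate N 0) (replicate M 0 @ [- 1 / 2]) (of_real x) (Complex c t) =
      gamma_factor M N (Complex (c + 1 / 2) t) / Complex (c + 1 / 2) t * exp (Complex (c + 1 / 2) t * of_real (ln x)) / of_real (sqrt x)"
      for t
      using meijer_integrand_first[of "Complex c t" x M N] that x by simp
    show ?thesis
      unfolding meijer_line_integral_eq eq
      unfolding integral_divide_zero using gamma_factor_integrand_integrable[OF MN c, of "ln x"] g[OF c]
      by (simp only: integrable_divide times_divide_eq_right conj_absorb simp_thms)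
  qed
  ultimately show "has_meijer_G M (N + 1) (1 / 2 # replicate N 0) (replicate M 0 @ [- 1 / 2]) (complex_of_real x) (g / of_real (sqrt x))"
    unfolding has_meijer_G_def meijer_separating_first by blast
qed

section \<open>Products and quotients of independent normal variables\<close>

context prob_space
begin

lemma normal_log_transform:
  fixes \<sigma> :: real and z :: complex
  assumes X: "distributed M lborel X (normal_density 0 \<sigma>)" and \<sigma>: "\<sigma> > 0" and z: "Re z > 0"
  shows "has_bochner_integral M (\<lambda>\<omega>. exp ((z - 1 / 2) * of_real (ln ((X \<omega>)\<^sup>2 / (2 * \<sigma>\<^sup>2)))))
    (Gamma z / of_real (sqrt pi))"
proof -
  let ?g = "\<lambda>x. exp ((z - 1 / 2) * of_real (ln (x\<^sup>2 / (2 * \<sigma>\<^sup>2))))"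
  have [measurable]: "?g \<in> borel_measurable borel" by measurable
  have [measurable]: "X \<in> borel_measurable M"
    using distributed_measurable[OF X] by simp
  have "has_bochner_integral (density lborel (normal_density 0 \<sigma>)) ?g (Gamma z / of_real (sqrt pi))"
    using normal_density_log_transform[OF \<sigma> z] by (intro has_bochner_integral_density) auto
  also have "density lborel (normal_density 0 \<sigma>) = distr M lborel X"
    using distributed_distr_eq_density[OF X] by simp
  finally show ?thesis
    by (simp add: has_bochner_integral_iff integrable_distr_eq integral_distr)
qed

lemma normal_AE_nonzero:
  assumes X: "distributed M lborel X (normal_density 0 \<sigma>)"
  shows "AE \<omega> in M. X \<omega> \<noteq> 0"
proof -
  have "AE x in density lborel (normal_density 0 \<sigma>). x \<noteq> 0"
    by (subst AE_density) (auto intro: eventually_mono[OF AE_lborel_singleton[of 0]])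
  then have "AE x in distr M lborel X. x \<noteq> 0"
    by (simp only: distributed_distr_eq_density[OF X])
  then show ?thesis
    using distributed_measurable[OF X] by (subst (asm) AE_distr_iff) auto
qed

lemma normal_distr_uminus:
  assumes X: "distributed M lborel X (normal_density 0 \<sigma>)" and \<sigma>: "\<sigma> > 0"
  shows "distr M borel (\<lambda>\<omega>. - X \<omega>) = distr M borel X"
proof -
  have "distributed M lborel (\<lambda>\<omega>. 0 + (- 1) * X \<omega>) (normal_density (0 + (- 1) * 0) (\<bar>- 1\<bar> * \<sigma>))"
    by (rule normal_density_affine[OF X \<sigma>]) auto
  then have "distr M lborel (\<lambda>\<omega>. - X \<omega>) = distr M lborel X"
    using distributed_distr_eq_density[OF X] by (auto dest: distributed_distr_eq_density)
  then show ?thesis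
    by (simp cong: distr_cong)
qed

text \<open>By independence the joint law of \<open>(U, R)\<close> is a product measure, hence
  unchanged when \<open>U\<close> changes sign; multiplication carries this over to
  \<open>U * R\<close>.\<close>

lemma indep_mult_distr_uminus:
  fixes U R :: "'a \<Rightarrow> real"
  assumes ind: "indep_var borel U borel R" and U: "distr M borel (\<lambda>\<omega>. - U \<omega>) = distr M borel U"
  shows "distr M borel (\<lambda>\<omega>. - (U \<omega> * R \<omega>)) = distr M borel (\<lambda>\<omega>. U \<omega> * R \<omega>)"
proof -
  have [measurable]: "U \<in> borel_measurable M" "R \<in> borel_measurable M"
    using ind indep_var_rv1 indep_var_rv2 by blast+
  have ind': "indep_var borel (\<lambda>\<omega>. - U \<omega>) borel R"
    using indep_var_compose[OF ind, of uminus borel id borel] by (simp add: o_def)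
  have "distr M (borel \<Otimes>\<^sub>M borel) (\<lambda>\<omega>. (- U \<omega>, R \<omega>)) = distr M (borel \<Otimes>\<^sub>M borel) (\<lambda>\<omega>. (U \<omega>, R \<omega>))"
    using ind ind' U unfolding indep_var_distribution_eq by simp
  from arg_cong[OF this, of "\<lambda>D. distr D borel (\<lambda>(u, r). u * r)"]
  show ?thesis
    by (simp add: distr_distr o_def)
qed

end

text \<open>Reflection gives \<open>{..z}\<close> the mass of \<open>{- z..}\<close>, and cutting
  the line at \<open>z\<close> and \<open>- z\<close> yields a linear equation for this mass. The
  sign of \<open>z\<close> decides whether the two half-lines overlap; endpoints have mass
  0.\<close>

lemma symmetric_measure_atMost:
  fixes D :: "real measure"
  assumes "real_distribution D" and sym: "distr D borel uminus = D"
    and no_atom: "\<And>a. measure D {a} = 0"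
  shows "measure D {..z} = 1 / 2 + sgn z / 2 * measure D {- \<bar>z\<bar>..\<bar>z\<bar>}"
proof -
  interpret real_distribution D by fact
  have Un: "measure D C = measure D A + measure D B"
    if "C = A \<union> B" "A \<inter> B = {}" "A \<in> sets borel" "B \<in> sets borel" for A B C
    using finite_measure_Union[of A B] that by simp
  have UNIV: "measure D UNIV = 1"
    using prob_space by simp
  have flip: "measure D (uminus -` A) = measure D A" if "A \<in> sets borel" for A
    using measure_distr[of uminus D borel A] that unfolding sym by simp
  have tail: "measure D {..z} = measure D {- z..}"
    using flip[of "{- z..}"] by (simp add: vimage_def atMost_def)
  have split: "measure D UNIV = measure D {..z} + measure D {z<..}"
    by (rule Un) auto
  consider "z > 0" | "z = 0" | "z < 0" by linarith
  then show ?thesis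
  proof cases
    case 1
    have "measure D {- z..} = measure D {- z..z} + measure D {z<..}"
      by (rule Un) (use 1 in auto)
    then show ?thesis using split UNIV tail 1 by simp
  next
    case 2
    have "measure D {- z..} = measure D {z} + measure D {z<..}"
      by (rule Un) (use 2 in auto)
    then show ?thesis using split UNIV tail 2 by (simp add: no_atom)
  next
    case 3
    have "measure D {z<..} = measure D {z<..<- z} + measure D {- z..}"
      by (rule Un) (use 3 in auto)
    moreover have "measure D {z..- z} = measure D {z} + measure D {z<..- z}"
      by (rule Un) (use 3 in auto)
    moreover have "measure D {z<..- z} = measure D {z<..<- z} + measure D {- z}"
      by (rule Un) (use 3 in auto)
    ultimately show ?thesis using split UNIV tail 3 by (simp add: no_atom)
  qed
qed

section \<open>The ratio \<open>Z\<close> and its logarithmic counterpart \<open>S\<close>\<close>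

locale normal_ratio = prob_space \<Omega> for \<Omega> :: "'a measure" +
  fixes M N :: nat and X Y :: "nat \<Rightarrow> 'a \<Rightarrow> real" and \<sigma>X \<sigma>Y :: "nat \<Rightarrow> real"
  assumes MN: "M + N \<ge> 1"
    and \<sigma>X: "\<And>i. i \<in> {1..M} \<Longrightarrow> \<sigma>X i > 0"
    and \<sigma>Y: "\<And>j. j \<in> {1..N} \<Longrightarrow> \<sigma>Y j > 0"
    and X: "\<And>i. i \<in> {1..M} \<Longrightarrow> distributed \<Omega> lborel (X i) (normal_density 0 (\<sigma>X i))"
    and Y: "\<And>j. j \<in> {1..N} \<Longrightarrow> distributed \<Omega> lborel (Y j) (normal_density 0 (\<sigma>Y j))"
    and indep: "indep_vars (\<lambda>_. borel) (case_sum X Y) ({1..M} <+> {1..N})"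
begin

definition Z :: "'a \<Rightarrow> real" where
  "Z \<omega> = (\<Prod>i=1..M. X i \<omega>) / (\<Prod>j=1..N. Y j \<omega>)"

text \<open>Dividing each square by \<open>2 * \<sigma>^2\<close> removes the deviation from the
  transform, and the minus sign places the \<open>Y j\<close> in the denominator. The index type is
  that of the joint independence hypothesis.\<close>

definition L :: "nat + nat \<Rightarrow> 'a \<Rightarrow> real" where
  "L k \<omega> = (case k of Inl i \<Rightarrow> ln ((X i \<omega>)\<^sup>2 / (2 * (\<sigma>X i)\<^sup>2)) | Inr j \<Rightarrow> - ln ((Y j \<omega>)\<^sup>2 / (2 * (\<sigma>Y j)\<^sup>2)))"

definition S :: "'a \<Rightarrow> real" where
  "S \<omega> = (\<Sum>k\<in>{1..M} <+> {1..N}. L k \<omega>)"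

definition \<kappa> :: real where
  "\<kappa> = 2 ^ N * (\<Prod>j=1..N. \<sigma>Y j)\<^sup>2 / (2 ^ M * (\<Prod>i=1..M. \<sigma>X i)\<^sup>2)"

lemma \<kappa>_pos: "\<kappa> > 0"
  unfolding \<kappa>_def using \<sigma>X \<sigma>Y by (intro divide_pos_pos mult_pos_pos zero_less_power prod_pos) auto

lemma X_measurable: "i \<in> {1..M} \<Longrightarrow> X i \<in> borel_measurable \<Omega>"
  using distributed_measurable[OF X] by simp

lemma Y_measurable: "j \<in> {1..N} \<Longrightarrow> Y j \<in> borel_measurable \<Omega>"
  using distributed_measurable[OF Y] by simp

lemma Z_measurable [measurable]: "Z \<in> borel_measurable \<Omega>"
  unfolding Z_def using X_measurable Y_measurable
  by (intro borel_measurable_divide borel_measurable_prod) auto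

lemma L_indep: "indep_vars (\<lambda>_. borel) L ({1..M} <+> {1..N})"
proof -
  define f :: "nat + nat \<Rightarrow> real \<Rightarrow> real" where
    "f k x = (case k of Inl i \<Rightarrow> ln (x\<^sup>2 / (2 * (\<sigma>X i)\<^sup>2)) | Inr j \<Rightarrow> - ln (x\<^sup>2 / (2 * (\<sigma>Y j)\<^sup>2)))" for k x
  have "indep_vars (\<lambda>_. borel) (\<lambda>k \<omega>. f k (case_sum X Y k \<omega>)) ({1..M} <+> {1..N})"
    by (rule indep_vars_compose2[OF indep]) (auto simp: f_def split: sum.split)
  also have "(\<lambda>k \<omega>. f k (case_sum X Y k \<omega>)) = L"
    by (auto simp: f_def L_def fun_eq_iff split: sum.split)
  finally show ?thesis .
qed

lemma S_measurable [measurable]: "S \<in> borel_measurable \<Omega>"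
  unfolding S_def using L_indep unfolding indep_vars_def
  by (intro borel_measurable_sum) auto

text \<open>This is \<open>normal_log_transform\<close> at \<open>z = 1 / 2 - s\<close> for a
  numerator and at \<open>z = 1 / 2 + s\<close> for a denominator. The bound
  \<open>Re s < 1 / 2\<close> keeps the first argument in the right half-plane.\<close>

lemma L_transform:
  assumes k: "k \<in> {1..M} <+> {1..N}" and s: "0 < Re s" "M > 0 \<longrightarrow> Re s < 1 / 2"
  shows "has_bochner_integral \<Omega> (\<lambda>\<omega>. exp (- s * of_real (L k \<omega>)))
    ((case k of Inl _ \<Rightarrow> Gamma (1 / 2 - s) | Inr _ \<Rightarrow> Gamma (1 / 2 + s)) / of_real (sqrt pi))"
proof (cases k)
  case (Inl i)
  then have "i \<in> {1..M}" using k by auto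
  with normal_log_transform[OF X \<sigma>X, of i "1 / 2 - s"] s show ?thesis
    by (simp add: L_def Inl)
next
  case (Inr j)
  then have "j \<in> {1..N}" using k by auto
  with normal_log_transform[OF Y \<sigma>Y, of j "1 / 2 + s"] s show ?thesis
    by (simp add: L_def Inr)
qed

text \<open>The exponential of the sum is a product of independent factors, so the expectations
  multiply.\<close>

lemma S_transform:
  assumes s: "0 < Re s" "M > 0 \<longrightarrow> Re s < 1 / 2"
  shows "has_bochner_integral \<Omega> (\<lambda>\<omega>. exp (- s * of_real (S \<omega>)))
    (gamma_factor M N s / of_real (sqrt pi ^ (M + N)))"
proof -
  let ?I = "{1..M} <+> {1..N}"
  have ind: "indep_vars (\<lambda>_. borel) (\<lambda>k \<omega>. exp (- s * of_real (L k \<omega>))) ?I"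
    by (rule indep_vars_compose2[OF L_indep]) auto
  have int: "integrable \<Omega> (\<lambda>\<omega>. exp (- s * of_real (L k \<omega>)))" if "k \<in> ?I" for k
    using L_transform[OF that s] by (simp add: has_bochner_integral_iff)
  have eq: "exp (- s * of_real (S \<omega>)) = (\<Prod>k\<in>?I. exp (- s * of_real (L k \<omega>)))" for \<omega>
    by (simp add: S_def sum_distrib_left flip: exp_sum)
  have "expectation (\<lambda>\<omega>. \<Prod>k\<in>?I. exp (- s * of_real (L k \<omega>))) =
      (\<Prod>k\<in>?I. (case k of Inl _ \<Rightarrow> Gamma (1 / 2 - s) | Inr _ \<Rightarrow> Gamma (1 / 2 + s)) / of_real (sqrt pi))"
    using L_transform[OF _ s]
    by (subst indep_vars_lebesgue_integral[OF _ ind int])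
       (auto simp: has_bochner_integral_iff intro!: prod.cong)
  also have "\<dots> = gamma_factor M N s / of_real (sqrt pi ^ (M + N))"
    by (simp add: prod.Plus gamma_factor_def power_divide power_add)
  finally show ?thesis
    unfolding eq has_bochner_integral_iff
    using indep_vars_integrable[OF _ ind int] by simp
qed

text \<open>These are the data that \<open>cdf_laplace_inversion\<close> requires of the law of
  \<open>S\<close>.\<close>

lemma S_laplace:
  assumes c: "0 < c" "M > 0 \<longrightarrow> c < 1 / 2"
  defines "D \<equiv> distr \<Omega> borel S"
  shows "real_distribution D" and "integrable D (\<lambda>x. exp (- c * x))"
    and "(CLINT x|D. exp (- Complex c t * of_real x)) = gamma_factor M N (Complex c t) / of_real (sqrt pi ^ (M + N))"
proof -
  show "real_distribution D"
    unfolding D_def by (rule real_distribution_distr) measurable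
  have "integrable \<Omega> (\<lambda>\<omega>. exp (- complex_of_real c * of_real (S \<omega>)))"
    using S_transform[of "of_real c"] c by (simp add: has_bochner_integral_iff)
  then have "integrable \<Omega> (\<lambda>\<omega>. complex_of_real (exp (- c * S \<omega>)))"
    by (simp flip: exp_of_real)
  then show "integrable D (\<lambda>x. exp (- c * x))"
    unfolding D_def complex_of_real_integrable_eq by (subst integrable_distr_eq) auto
  show "(CLINT x|D. exp (- Complex c t * of_real x)) = gamma_factor M N (Complex c t) / of_real (sqrt pi ^ (M + N))"
    unfolding D_def using S_transform[of "Complex c t"] c
    by (subst integral_distr) (auto simp: has_bochner_integral_iff)
qed

text \<open>The left-hand side of the first identity does not contain \<open>c\<close>, so the
  inversion integral has the same value on all admissible lines, as \<open>meijer_G_second\<close>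
  and \<open>meijer_G_first\<close> require.\<close>

lemma S_cdf:
  assumes c: "0 < c" "M > 0 \<longrightarrow> c < 1 / 2"
  shows "complex_of_real (sqrt pi ^ (M + N) * prob {\<omega> \<in> space \<Omega>. S \<omega> \<le> y}) =
     1 / (2 * pi) * (CLINT t|lborel. gamma_factor M N (Complex c t) / Complex c t * exp (Complex c t * of_real y))"
    and "prob {\<omega> \<in> space \<Omega>. S \<omega> = y} = 0"
proof -
  define D where "D = distr \<Omega> borel S"
  define q where "q = complex_of_real (sqrt pi ^ (M + N))"
  have q: "q \<noteq> 0" by (simp add: q_def)
  note D = S_laplace[OF c, folded D_def q_def]
  interpret D: real_distribution D by (rule D(1))
  have int: "integrable lborel (\<lambda>t. (CLINT x|D. exp (- Complex c t * of_real x)) / Complex c t)"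
    unfolding D(3) using integrable_divide_zero[OF gamma_factor_integrable[OF MN c], of q]
    by (simp add: mult.commute)
  have "cdf D y = prob {\<omega> \<in> space \<Omega>. S \<omega> \<le> y}"
    unfolding cdf_def D_def by (subst measure_distr) (auto intro!: arg_cong[where f=prob])
  moreover have "q * complex_of_real (cdf D y) =
     1 / (2 * pi) * (CLINT t|lborel. gamma_factor M N (Complex c t) / Complex c t * exp (Complex c t * of_real y))"
  proof -
    have "(CLINT t|lborel. gamma_factor M N (Complex c t) / q / Complex c t * exp (Complex c t * of_real y)) =
        (CLINT t|lborel. (gamma_factor M N (Complex c t) / Complex c t * exp (Complex c t * of_real y)) / q)"
      by (intro Bochner_Integration.integral_cong) auto
    also have "\<dots> = (CLINT t|lborel. gamma_factor M N (Complex c t) / Complex c t * exp (Complex c t * of_real y)) / q"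
      by (rule integral_divide_zero)
    finally show ?thesis
      unfolding D.cdf_laplace_inversion[OF c(1) D(2) int] D(3) using q by simp
  qed
  ultimately show "complex_of_real (sqrt pi ^ (M + N) * prob {\<omega> \<in> space \<Omega>. S \<omega> \<le> y}) =
     1 / (2 * pi) * (CLINT t|lborel. gamma_factor M N (Complex c t) / Complex c t * exp (Complex c t * of_real y))"
    by (simp add: q_def)
  have "measure D {y} = prob {\<omega> \<in> space \<Omega>. S \<omega> = y}"
    unfolding D_def by (subst measure_distr) (auto intro!: arg_cong[where f=prob])
  then show "prob {\<omega> \<in> space \<Omega>. S \<omega> = y} = 0"
    using D.cdf_laplace_no_atom[OF c(1) D(2) int] by simp
qed

text \<open>Almost surely no factor vanishes, so the logarithms add up to that of a product; the
  factors \<open>2 * \<sigma>^2\<close> collect in \<open>\<kappa>\<close>.\<close>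

lemma S_eq:
  "AE \<omega> in \<Omega>. Z \<omega> \<noteq> 0 \<and> S \<omega> = ln (\<kappa> * (Z \<omega>)\<^sup>2)"
proof -
  have "AE \<omega> in \<Omega>. \<forall>i\<in>{1..M}. X i \<omega> \<noteq> 0"
    by (intro AE_finite_allI normal_AE_nonzero[OF X]) auto
  moreover have "AE \<omega> in \<Omega>. \<forall>j\<in>{1..N}. Y j \<omega> \<noteq> 0"
    by (intro AE_finite_allI normal_AE_nonzero[OF Y]) auto
  ultimately show ?thesis
  proof eventually_elim
    case (elim \<omega>)
    let ?A = "\<Prod>i=1..M. (X i \<omega>)\<^sup>2 / (2 * (\<sigma>X i)\<^sup>2)" and ?B = "\<Prod>j=1..N. (Y j \<omega>)\<^sup>2 / (2 * (\<sigma>Y j)\<^sup>2)"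
    have pos: "(X i \<omega>)\<^sup>2 / (2 * (\<sigma>X i)\<^sup>2) > 0" if "i \<in> {1..M}" for i
      using elim(1) \<sigma>X[OF that] that by simp
    have pos': "(Y j \<omega>)\<^sup>2 / (2 * (\<sigma>Y j)\<^sup>2) > 0" if "j \<in> {1..N}" for j
      using elim(2) \<sigma>Y[OF that] that by simp
    have "S \<omega> = ln ?A - ln ?B"
    proof -
      have "ln ?A = (\<Sum>i=1..M. ln ((X i \<omega>)\<^sup>2 / (2 * (\<sigma>X i)\<^sup>2)))"
        by (rule ln_prod[OF finite_atLeastAtMost less_imp_neq[OF pos, symmetric]])
      moreover have "ln ?B = (\<Sum>j=1..N. ln ((Y j \<omega>)\<^sup>2 / (2 * (\<sigma>Y j)\<^sup>2)))"
        by (rule ln_prod[OF finite_atLeastAtMost less_imp_neq[OF pos', symmetric]])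
      ultimately show ?thesis by (simp add: S_def sum.Plus L_def sum_negf)
    qed
    also have "\<dots> = ln (?A / ?B)"
    proof -
      have "?A > 0" by (rule prod_pos) (rule pos)
      moreover have "?B > 0" by (rule prod_pos) (rule pos')
      ultimately show ?thesis by (rule ln_divide_pos[symmetric])
    qed
    also have "?A / ?B = \<kappa> * (Z \<omega>)\<^sup>2"
      by (simp add: \<kappa>_def Z_def prod_dividef prod.distrib power_divide prod_power_distrib)
    finally show ?case using elim by (simp add: Z_def)
  qed
qed

lemma Z_modulus:
  assumes "z \<noteq> 0"
  shows "prob {\<omega> \<in> space \<Omega>. S \<omega> \<le> ln (\<kappa> * z\<^sup>2)} = prob {\<omega> \<in> space \<Omega>. - \<bar>z\<bar> \<le> Z \<omega> \<and> Z \<omega> \<le> \<bar>z\<bar>}"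
proof (rule finite_measure_eq_AE)
  show "AE \<omega> in \<Omega>. \<omega> \<in> {\<omega> \<in> space \<Omega>. S \<omega> \<le> ln (\<kappa> * z\<^sup>2)} \<longleftrightarrow>
      \<omega> \<in> {\<omega> \<in> space \<Omega>. - \<bar>z\<bar> \<le> Z \<omega> \<and> Z \<omega> \<le> \<bar>z\<bar>}"
    using S_eq
  proof eventually_elim
    case (elim \<omega>)
    \<comment> \<open>Both arguments of \<open>ln\<close> are positive since
      \<open>\<kappa> > 0\<close> and neither \<open>z\<close> nor \<open>Z \<omega>\<close> is 0,
      so \<open>ln\<close> is strictly increasing here.\<close>
    then have "S \<omega> \<le> ln (\<kappa> * z\<^sup>2) \<longleftrightarrow> (Z \<omega>)\<^sup>2 \<le> z\<^sup>2"
      using assms \<kappa>_pos by simp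
    also have "\<dots> \<longleftrightarrow> \<bar>Z \<omega>\<bar> \<le> \<bar>z\<bar>"
      by (rule abs_le_square_iff[symmetric])
    finally show ?case by auto
  qed
qed measurable

text \<open>Almost surely \<open>Z = a\<close> forces \<open>S = ln (\<kappa> * a^2)\<close>, an
  event of probability 0. For \<open>a = 0\<close> this holds whatever value \<open>ln\<close> has
  at 0.\<close>

lemma Z_no_atom: "prob {\<omega> \<in> space \<Omega>. Z \<omega> = a} = 0"
proof -
  obtain c :: real where c: "0 < c" "M > 0 \<longrightarrow> c < 1 / 2"
    by (rule that[of "1 / 4"]) auto
  have "AE \<omega> in \<Omega>. S \<omega> \<noteq> ln (\<kappa> * a\<^sup>2)"
    using S_cdf(2)[OF c, of "ln (\<kappa> * a\<^sup>2)"] by (subst (asm) prob_eq_0) auto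
  with S_eq have "AE \<omega> in \<Omega>. Z \<omega> \<noteq> a"
    by eventually_elim auto
  then show ?thesis
    by (subst prob_eq_0) auto
qed

text \<open>\<open>Z\<close> is the product of the independent symmetric variables
  \<open>X i\<close> and \<open>inverse (Y j)\<close>, and changing the sign of one factor changes
  the sign of \<open>Z\<close>.\<close>

lemma Z_symmetric: "distr \<Omega> borel (\<lambda>\<omega>. - Z \<omega>) = distr \<Omega> borel Z"
proof -
  let ?I = "{1..M} <+> {1..N}"
  define V where "V k \<omega> = (case k of Inl i \<Rightarrow> X i \<omega> | Inr j \<Rightarrow> inverse (Y j \<omega>))" for k \<omega>
  define g :: "nat + nat \<Rightarrow> real \<Rightarrow> real" where "g k x = (case k of Inl i \<Rightarrow> x | Inr j \<Rightarrow> inverse x)" for k x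
  have "indep_vars (\<lambda>_. borel) (\<lambda>k \<omega>. g k (case_sum X Y k \<omega>)) ?I"
    by (rule indep_vars_compose2[OF indep]) (auto simp: g_def split: sum.split)
  also have "(\<lambda>k \<omega>. g k (case_sum X Y k \<omega>)) = V"
    by (auto simp: g_def V_def fun_eq_iff split: sum.split)
  finally have V: "indep_vars (\<lambda>_. borel) V ?I" .
  have V_sym: "distr \<Omega> borel (\<lambda>\<omega>. - V k \<omega>) = distr \<Omega> borel (V k)" if "k \<in> ?I" for k
  proof (cases k)
    case (Inl i)
    then have "i \<in> {1..M}" using that by auto
    then show ?thesis using normal_distr_uminus[OF X \<sigma>X] by (simp add: V_def[abs_def] Inl)
  next
    case (Inr j)
    then have j: "j \<in> {1..N}" using that by auto
    note [measurable] = Y_measurable[OF j]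
    from arg_cong[OF normal_distr_uminus[OF Y[OF j] \<sigma>Y[OF j]], of "\<lambda>D. distr D borel inverse"]
    show ?thesis by (simp add: distr_distr o_def V_def[abs_def] Inr)
  qed
  \<comment> \<open>The assumption \<open>M + N \<ge> 1\<close> provides a factor whose sign can be
    changed.\<close>
  have "?I \<noteq> {}" using MN by (cases "M = 0") auto
  then obtain k where k: "k \<in> ?I" by blast
  then have "insert k (?I - {k}) = ?I" by auto
  then have "indep_var borel (V k) borel (\<lambda>\<omega>. \<Prod>l\<in>?I - {k}. V l \<omega>)"
    using V by (intro indep_vars_prod) auto
  from indep_mult_distr_uminus[OF this V_sym[OF k]]
  moreover have "V k \<omega> * (\<Prod>l\<in>?I - {k}. V l \<omega>) = (\<Prod>l\<in>?I. V l \<omega>)" for \<omega>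
    using k by (intro prod.remove[symmetric]) auto
  moreover have "(\<Prod>l\<in>?I. V l \<omega>) = Z \<omega>" for \<omega>
    using prod_inversef[of "\<lambda>j. Y j \<omega>" "{1..N}"]
    by (simp add: prod.Plus V_def Z_def divide_inverse o_def)
  ultimately show ?thesis by simp
qed

lemma Z_cdf:
  "prob {\<omega> \<in> space \<Omega>. Z \<omega> \<le> z} = 1 / 2 + sgn z / 2 * prob {\<omega> \<in> space \<Omega>. S \<omega> \<le> ln (\<kappa> * z\<^sup>2)}"
proof -
  define D where "D = distr \<Omega> borel Z"
  have D_prob: "measure D {x. P x} = prob {\<omega> \<in> space \<Omega>. P (Z \<omega>)}" if "{x. P x} \<in> sets borel" for P
    unfolding D_def using that by (subst measure_distr) (auto intro!: arg_cong[where f=prob])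
  have "real_distribution D"
    unfolding D_def by (rule real_distribution_distr) measurable
  moreover have "distr D borel uminus = D"
    unfolding D_def by (simp add: distr_distr o_def Z_symmetric)
  moreover have "measure D {a} = 0" for a
    using D_prob[of "\<lambda>x. x = a"] Z_no_atom[of a] by simp
  ultimately have "measure D {..z} = 1 / 2 + sgn z / 2 * measure D {- \<bar>z\<bar>..\<bar>z\<bar>}"
    by (rule symmetric_measure_atMost)
  moreover have "measure D {..z} = prob {\<omega> \<in> space \<Omega>. Z \<omega> \<le> z}"
    using D_prob[of "\<lambda>x. x \<le> z"] by (simp add: atMost_def)
  moreover have "measure D {- \<bar>z\<bar>..\<bar>z\<bar>} = prob {\<omega> \<in> space \<Omega>. S \<omega> \<le> ln (\<kappa> * z\<^sup>2)}" if "z \<noteq> 0"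
    using D_prob[of "\<lambda>x. - \<bar>z\<bar> \<le> x \<and> x \<le> \<bar>z\<bar>"] Z_modulus[OF that]
    by (simp add: atLeastAtMost_def atLeast_def atMost_def Collect_conj_eq)
  \<comment> \<open>For \<open>z = 0\<close> the factor \<open>sgn z\<close> removes the term that
    contains \<open>ln 0\<close>.\<close>
  ultimately show ?thesis by (cases "z = 0") auto
qed

end

theorem theorem2p2:
  fixes \<Omega> :: "'a measure"
    and M N :: nat
    and X Y :: "nat \<Rightarrow> 'a \<Rightarrow> real"
    and \<sigma>X \<sigma>Y :: "nat \<Rightarrow> real"
    and z :: real
  assumes "prob_space \<Omega>"
    and "M + N \<ge> 1"
    and "\<And>i. i \<in> {1..M} \<Longrightarrow> \<sigma>X i > 0"
    and "\<And>j. j \<in> {1..N} \<Longrightarrow> \<sigma>Y j > 0"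
    and "\<And>i. i \<in> {1..M} \<Longrightarrow> distributed \<Omega> lborel (X i) (normal_density 0 (\<sigma>X i))"
    and "\<And>j. j \<in> {1..N} \<Longrightarrow> distributed \<Omega> lborel (Y j) (normal_density 0 (\<sigma>Y j))"
    and "prob_space.indep_vars \<Omega> (\<lambda>_. borel) (case_sum X Y) ({1..M} <+> {1..N})"
  shows "let \<sigma> = (\<Prod>i=1..M. \<sigma>X i);
             s = (\<Prod>j=1..N. \<sigma>Y j);
             Z = (\<lambda>\<omega>. (\<Prod>i=1..M. X i \<omega>) / (\<Prod>j=1..N. Y j \<omega>));
             F = measure \<Omega> {\<omega> \<in> space \<Omega>. Z \<omega> \<le> z};
             x = 2 ^ N * s\<^sup>2 / (2 ^ M * \<sigma>\<^sup>2) * z\<^sup>2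
         in complex_of_real F =
              1 / 2 +
              complex_of_real
                (2 powr ((real N - real M - 2) / 2) * s / (pi powr ((real M + real N) / 2) * \<sigma>) * z) *
              meijer_G M (N + 1) (1 / 2 # replicate N 0) (replicate M 0 @ [- 1 / 2])
                (complex_of_real x) \<and>
            complex_of_real F =
              1 / 2 +
              complex_of_real (sgn z / (2 * pi powr ((real N + real M) / 2))) *
              meijer_G M (N + 1) (1 # replicate N (1 / 2)) (replicate M (1 / 2) @ [0])
                (complex_of_real x)"
proof -
  interpret normal_ratio \<Omega> M N X Y \<sigma>X \<sigma>Y
    using assms by (intro normal_ratio.intro normal_ratio_axioms.intro)
  define \<sigma> where "\<sigma> = (\<Prod>i=1..M. \<sigma>X i)"
  define s where "s = (\<Prod>j=1..N. \<sigma>Y j)"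
  define q where "q = sqrt pi ^ (M + N)"
  define p where "p = prob {\<omega> \<in> space \<Omega>. S \<omega> \<le> ln (\<kappa> * z\<^sup>2)}"
  define G1 where "G1 = meijer_G M (N + 1) (1 / 2 # replicate N 0) (replicate M 0 @ [- 1 / 2]) (complex_of_real (\<kappa> * z\<^sup>2))"
  define G2 where "G2 = meijer_G M (N + 1) (1 # replicate N (1 / 2)) (replicate M (1 / 2) @ [0]) (complex_of_real (\<kappa> * z\<^sup>2))"
  have \<sigma>: "\<sigma> > 0" unfolding \<sigma>_def using assms(3) by (intro prod_pos) auto
  have s: "s > 0" unfolding s_def using assms(4) by (intro prod_pos) auto
  have q: "q > 0" by (simp add: q_def)
  have q_powr: "pi powr ((real M + real N) / 2) = q"
  proof -
    have "q = sqrt pi powr real (M + N)" unfolding q_def by (rule powr_realpow[symmetric]) simp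
    then show ?thesis by (simp add: powr_half_sqrt[symmetric] powr_powr)
  qed
  have \<kappa>: "\<kappa> = 2 ^ N * s\<^sup>2 / (2 ^ M * \<sigma>\<^sup>2)"
    by (simp only: \<kappa>_def \<sigma>_def s_def)
  have sqrt_\<kappa>: "sqrt \<kappa> = 2 powr ((real N - real M) / 2) * s / \<sigma>"
  proof -
    have "sqrt \<kappa> = sqrt (2 ^ N / 2 ^ M) * (s / \<sigma>)"
      using \<sigma> s by (simp add: \<kappa> real_sqrt_mult real_sqrt_divide)
    also have "sqrt (2 ^ N / 2 ^ M) = 2 powr ((real N - real M) / 2)"
      by (simp add: powr_half_sqrt[symmetric] powr_realpow[symmetric] powr_diff[symmetric] powr_powr)
    finally show ?thesis by simp
  qed
  have F: "prob {\<omega> \<in> space \<Omega>. Z \<omega> \<le> z} = 1 / 2 + sgn z / 2 * p"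
    unfolding p_def by (rule Z_cdf)
  have "complex_of_real (1 / 2 + sgn z / 2 * p) =
      1 / 2 + complex_of_real (2 powr ((real N - real M - 2) / 2) * s / (q * \<sigma>) * z) * G1 \<and>
    complex_of_real (1 / 2 + sgn z / 2 * p) = 1 / 2 + complex_of_real (sgn z / (2 * q)) * G2"
  \<comment> \<open>At \<open>z = 0\<close> both prefactors are 0, so the products vanish whatever
    \<open>G1\<close> and \<open>G2\<close> are, in agreement with the limit convention.\<close>
  proof (cases "z = 0")
    case False
    then have x: "\<kappa> * z\<^sup>2 > 0" using \<kappa>_pos by simp
    note cdf = S_cdf(1)[where y = "ln (\<kappa> * z\<^sup>2)", folded p_def q_def]
    have G2: "G2 = of_real (q * p)"
      unfolding G2_def by (rule meijer_G_second[OF assms(2) x cdf])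
    have G1: "G1 = of_real (q * p) / of_real (sqrt (\<kappa> * z\<^sup>2))"
      unfolding G1_def by (rule meijer_G_first[OF assms(2) x cdf])
    \<comment> \<open>The \<open>- 2\<close> in the exponent is the factor \<open>1 / 2\<close>; the
      rest of the prefactor is \<open>sqrt \<kappa> * z / q\<close>.\<close>
    have "2 powr ((real N - real M - 2) / 2) = 2 powr ((real N - real M) / 2) / 2"
      by (simp add: diff_divide_distrib powr_diff)
    then have "2 powr ((real N - real M - 2) / 2) * s / (q * \<sigma>) * z = sqrt \<kappa> * z / (2 * q)"
      unfolding sqrt_\<kappa> by (simp only:) (simp add: mult_ac)
    \<comment> \<open>The square root of \<open>\<kappa> * z^2\<close> is
      \<open>sqrt \<kappa> * \<bar>z\<bar>\<close>, and \<open>z / \<bar>z\<bar>\<close> is the sign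
      of \<open>z\<close>.\<close>
    then have "2 powr ((real N - real M - 2) / 2) * s / (q * \<sigma>) * z * (q * p / sqrt (\<kappa> * z\<^sup>2)) = sgn z / 2 * p"
      using q False \<kappa>_pos by (simp add: real_sqrt_mult sgn_if)
    then have "complex_of_real (2 powr ((real N - real M - 2) / 2) * s / (q * \<sigma>) * z) * G1 = of_real (sgn z / 2 * p)"
      unfolding G1 of_real_mult[symmetric] of_real_divide[symmetric] by (rule arg_cong)
    moreover have "complex_of_real (sgn z / (2 * q)) * G2 = of_real (sgn z / 2 * p)"
      unfolding G2 of_real_mult[symmetric] using q by simp
    ultimately show ?thesis by simp
  qed simp
  then show ?thesis
    unfolding Let_def F[unfolded Z_def, symmetric] G1_def G2_def \<kappa>_def \<sigma>_def s_def q_powr[symmetric]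
      add.commute[of "real N" "real M"] .
qed

end
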